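(* Let $\Bbbk$ be a field of characteristic zero. In the six variables $x_1,x_2,x_3,y_1,y_2,y_3$, put $u=1+x_1x_2$ and $$\begin{aligned}\varphi={}&y_1\bigl(u^3x_3+x_2^2u(4+3x_1x_2)\bigr)\\&+y_2\bigl(x_2+3x_1u^2x_3+3x_1x_2^2(4+3x_1x_2)\bigr)\\&+y_3\bigl(2x_1-3x_1^2x_2-x_1^3x_3\bigr).\end{aligned}$$ Then $\det\operatorname{Hess}\varphi\equiv-4$ (identically as a polynomial), while the gradient map $\nabla\varphi:\Bbbk^6\to\Bbbk^6$ is not injective; consequently, the formal Legendre transform $\varphi^{L}$ is not a polynomial and the Hessian conjecture $\mathrm{HC}_6$ (over $\Bbbk$) is false.
   Context: For a polynomial $\varphi\in\Bbbk[x_1,\dots,x_n]$, $\nabla\varphi$ is its gradient, regarded as a polynomial map $\Bbbk^n\to\Bbbk^n$, and $\operatorname{Hess}\varphi$ is its matrix of second partial derivatives (with respect to all $n$ variables). Formal Legendre transform: if $\det\operatorname{Hess}\varphi\in\Bbbk^{\times}$ (a nonzero constant), then $\operatorname{Hess}\varphi(0)$ is invertible, so with $p_0=\nabla\varphi(0)$ the equation $p=\nabla\varphi(x)$ has a unique formal inverse $x(p)\in\Bbbk[[p-p_0]]^n$ with $x(p_0)=0$. The formal Legendre transform of $\varphi$ is the formal power series $\varphi^{L}(p)=\langle p,x(p)\rangle-\varphi(x(p))\in\Bbbk[[p-p_0]]$; equivalently $\nabla\varphi^{L}=(\nabla\varphi)^{-1}$ as formal maps. "$\varphi^L$ is a polynomial"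 means that this power series has only finitely many nonzero terms. Hessian conjecture $\mathrm{HC}_n$ (over $\Bbbk$): if $\varphi\in\Bbbk[x_1,\dots,x_n]$ has $\det\operatorname{Hess}\varphi\in\Bbbk^{\times}$, then $\varphi^{L}$ is a polynomial. *)

theory Defs
  imports "Jordan_Normal_Form.Determinant" "HOL-Library.Poly_Mapping"
begin

section \<open>Polynomials in countably many variables\<close>

text \<open>A monomial is a finitely supported exponent vector; the product of
  \<^typ>\<open>(nat \<Rightarrow>\<^sub>0 nat) \<Rightarrow>\<^sub>0 'a::comm_ring_1\<close> is convolution, i.e. multiplication of polynomials.
  The polynomials in \<open>n\<close> variables are those that involve only the variables with index \<open>< n\<close>.\<close>

type_synonym monomial = "nat \<Rightarrow>\<^sub>0 nat"
type_synonym 'a mpoly = "monomial \<Rightarrow>\<^sub>0 'a"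

definition mpolys :: "nat \<Rightarrow> 'a::zero mpoly set" where
  "mpolys n = {f. \<forall>m \<in> Poly_Mapping.keys f. Poly_Mapping.keys m \<subseteq> {..<n}}"

definition mp_const :: "'a::zero \<Rightarrow> 'a mpoly" where
  "mp_const c = Poly_Mapping.single 0 c"

definition mp_var :: "nat \<Rightarrow> 'a::zero_neq_one mpoly" where
  "mp_var i = Poly_Mapping.single (Poly_Mapping.single i 1) 1"

definition mp_deriv :: "nat \<Rightarrow> 'a::comm_ring_1 mpoly \<Rightarrow> 'a mpoly" where
  "mp_deriv i f = (\<Sum>m \<in> Poly_Mapping.keys f.
     Poly_Mapping.single (m - Poly_Mapping.single i 1)
       (of_nat (Poly_Mapping.lookup m i) * Poly_Mapping.lookup f m))"

text \<open>Evaluation at a point of a commutative ring \<open>'b\<close>; the map \<open>c\<close> sends the coefficients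
  into \<open>'b\<close>.\<close>

definition mp_eval ::
  "('a::zero \<Rightarrow> 'b::comm_ring_1) \<Rightarrow> 'b vec \<Rightarrow> 'a mpoly \<Rightarrow> 'b" where
  "mp_eval c x f = (\<Sum>m \<in> Poly_Mapping.keys f. c (Poly_Mapping.lookup f m) *
     (\<Prod>i \<in> Poly_Mapping.keys m. (x $ i) ^ Poly_Mapping.lookup m i))"

definition grad :: "nat \<Rightarrow> 'a::comm_ring_1 mpoly \<Rightarrow> 'a mpoly vec" where
  "grad n f = vec n (\<lambda>i. mp_deriv i f)"

definition Hess :: "nat \<Rightarrow> 'a::comm_ring_1 mpoly \<Rightarrow> 'a mpoly mat" where
  "Hess n f = mat n n (\<lambda>(i, j). mp_deriv i (mp_deriv j f))"

definition grad_map :: "nat \<Rightarrow> 'a::comm_ring_1 mpoly \<Rightarrow> 'a vec \<Rightarrow> 'a vec" where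
  "grad_map n f v = map_vec (mp_eval (\<lambda>c. c) v) (grad n f)"


section \<open>Formal power series in countably many variables\<close>

typedef 'a mfps = "UNIV :: (monomial \<Rightarrow> 'a) set"
  morphisms mfps_coeff Mfps by simp

lemma mfps_coeff_Mfps [simp]: "mfps_coeff (Mfps f) = f"
  by (simp add: Mfps_inverse)

lemma mfps_eq_iff: "f = g \<longleftrightarrow> (\<forall>m. mfps_coeff f m = mfps_coeff g m)"
  by (metis ext mfps_coeff_inject)

definition splits :: "monomial \<Rightarrow> (monomial \<times> monomial) set" where
  "splits m = {(a, b). a + b = m}"

lemma finite_splits [simp]: "finite (splits m)"
proof -
  let ?K = "Poly_Mapping.keys m"
  let ?S = "{f. \<forall>i. (i \<in> ?K \<longrightarrow> f i \<in> {..Max (Poly_Mapping.lookup m ` ?K)}) \<and> (i \<notin> ?K \<longrightarrow> f i = 0)}"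
  have fin: "finite ?S"
    by (rule finite_set_of_finite_funs) auto
  have "Poly_Mapping.lookup ` fst ` splits m \<subseteq> ?S"
  proof (clarsimp simp: splits_def)
    fix a b :: monomial and i
    assume m: "m = a + b"
    have le: "Poly_Mapping.lookup a i \<le> Poly_Mapping.lookup (a + b) i"
      by (simp add: lookup_add)
    show "(i \<in> Poly_Mapping.keys (a + b) \<longrightarrow>
        Poly_Mapping.lookup a i \<le> Max (Poly_Mapping.lookup (a + b) ` Poly_Mapping.keys (a + b))) \<and>
      (i \<notin> Poly_Mapping.keys (a + b) \<longrightarrow> Poly_Mapping.lookup a i = 0)"
    proof (intro conjI impI)
      assume "i \<in> Poly_Mapping.keys (a + b)"
      then have "Poly_Mapping.lookup (a + b) i
          \<le> Max (Poly_Mapping.lookup (a + b) ` Poly_Mapping.keys (a + b))"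
        by (intro Max_ge) auto
      with le show "Poly_Mapping.lookup a i
          \<le> Max (Poly_Mapping.lookup (a + b) ` Poly_Mapping.keys (a + b))"
        by linarith
    next
      assume "i \<notin> Poly_Mapping.keys (a + b)"
      with le show "Poly_Mapping.lookup a i = 0"
        by (simp add: in_keys_iff)
    qed
  qed
  then have "finite (Poly_Mapping.lookup ` fst ` splits m)"
    using fin by (rule finite_subset)
  then have "finite (fst ` splits m)"
    by (rule finite_imageD) (auto intro!: inj_onI poly_mapping_eqI)
  moreover have "inj_on fst (splits m)"
    by (auto simp: splits_def inj_on_def)
  ultimately show ?thesis
    by (rule finite_imageD)
qed

instantiation mfps :: (comm_ring_1) comm_ring_1
begin

definition "0 = Mfps (\<lambda>_. 0)"
definition "1 = Mfps (\<lambda>m. if m = 0 then 1 else 0)"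
definition "f + g = Mfps (\<lambda>m. mfps_coeff f m + mfps_coeff g m)"
definition "- f = Mfps (\<lambda>m. - mfps_coeff f m)"
definition "f - g = Mfps (\<lambda>m. mfps_coeff f m - mfps_coeff g m)"
definition "f * g = Mfps (\<lambda>m. \<Sum>(a, b) \<in> splits m. mfps_coeff f a * mfps_coeff g b)"

instance
proof
  fix f g h :: "'a mfps"
  show "f * g * h = f * (g * h)"
  proof -
    have "(\<Sum>(d, c) \<in> splits m. (\<Sum>(a, b) \<in> splits d. mfps_coeff f a * mfps_coeff g b) * mfps_coeff h c)
        = (\<Sum>(a, d) \<in> splits m. mfps_coeff f a * (\<Sum>(b, c) \<in> splits d. mfps_coeff g b * mfps_coeff h c))"
      for m
      unfolding sum_distrib_left sum_distrib_right case_prod_unfold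
      by (subst (1 2) sum.Sigma; simp?)
        (rule sum.reindex_bij_witness
          [where i = "\<lambda>((a, d), (b, c)). ((a + b, c), (a, b))"
             and j = "\<lambda>((d, c), (a, b)). ((a, b + c), (b, c))"];
          auto simp: splits_def add.assoc mult.assoc)
    then show ?thesis
      by (simp add: times_mfps_def mfps_eq_iff)
  qed
  show "f * g = g * f"
  proof -
    have "(\<Sum>(a, b) \<in> splits m. mfps_coeff f a * mfps_coeff g b)
        = (\<Sum>(a, b) \<in> splits m. mfps_coeff g a * mfps_coeff f b)" for m
      by (rule sum.reindex_bij_witness[where i = prod.swap and j = prod.swap])
        (auto simp: splits_def add.commute mult.commute)
    then show ?thesis
      by (simp add: times_mfps_def mfps_eq_iff)
  qed
  show "1 * f = f"
  proof -
    have "(\<Sum>(a, b) \<in> splits m. (if a = 0 then 1 else 0) * mfps_coeff f b) = mfps_coeff f m" for m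
    proof -
      have "(\<Sum>(a, b) \<in> splits m. (if a = 0 then 1 else 0) * mfps_coeff f b)
          = (\<Sum>(a, b) \<in> {(0 :: monomial, m)}. (if a = 0 then 1 else 0) * mfps_coeff f b)"
        by (rule sum.mono_neutral_right, simp) (auto simp: splits_def split: if_splits)
      then show ?thesis by simp
    qed
    then show ?thesis
      by (simp add: times_mfps_def one_mfps_def mfps_eq_iff)
  qed
  show "(f + g) * h = f * h + g * h"
    by (simp add: times_mfps_def plus_mfps_def mfps_eq_iff case_prod_unfold
        distrib_right sum.distrib)
qed (simp_all add: zero_mfps_def one_mfps_def plus_mfps_def uminus_mfps_def minus_mfps_def
    mfps_eq_iff add_ac)

end

definition mfps_in :: "nat \<Rightarrow> 'a::zero mfps set" where
  "mfps_in n = {f. \<forall>m. mfps_coeff f m \<noteq> 0 \<longrightarrow> Poly_Mapping.keys m \<subseteq> {..<n}}"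

definition mfps_const :: "'a::zero \<Rightarrow> 'a mfps" where
  "mfps_const c = Mfps (\<lambda>m. if m = 0 then c else 0)"

definition mfps_var :: "nat \<Rightarrow> 'a::zero_neq_one mfps" where
  "mfps_var i = Mfps (\<lambda>m. if m = Poly_Mapping.single i 1 then 1 else 0)"

definition is_polynomial :: "'a::zero mfps \<Rightarrow> bool" where
  "is_polynomial f \<longleftrightarrow> finite {m. mfps_coeff f m \<noteq> 0}"


section \<open>The formal Legendre transform\<close>

text \<open>Elements of \<open>k[[p - p0]]\<close> are represented as power series in the shifted variables
  \<open>q = p - p0\<close>, so that \<open>mfps_var i\<close> stands for \<open>p i - p0 i\<close>, and the value of a series
  at \<open>p0\<close> is its constant coefficient.  Here \<open>p0 = \<nabla>f(0)\<close>.\<close>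

definition dual_vars :: "nat \<Rightarrow> 'a::comm_ring_1 mpoly \<Rightarrow> 'a mfps vec" where
  "dual_vars n f = vec n (\<lambda>i. mfps_const (grad_map n f (0\<^sub>v n) $ i) + mfps_var i)"

definition is_formal_inverse :: "nat \<Rightarrow> 'a::comm_ring_1 mpoly \<Rightarrow> 'a mfps vec \<Rightarrow> bool" where
  "is_formal_inverse n f x \<longleftrightarrow>
     x \<in> carrier_vec n \<and>
     (\<forall>i<n. x $ i \<in> mfps_in n \<and> mfps_coeff (x $ i) 0 = 0) \<and>
     map_vec (mp_eval mfps_const x) (grad n f) = dual_vars n f"

text \<open>The formal inverse exists and is unique when \<open>f\<close> is a polynomial in \<open>n\<close> variables
  over a field and \<open>det (Hess n f)\<close> is a nonzero constant; otherwise \<open>legendre n f\<close> need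
  not be meaningful.\<close>

definition formal_inverse :: "nat \<Rightarrow> 'a::comm_ring_1 mpoly \<Rightarrow> 'a mfps vec" where
  "formal_inverse n f = (THE x. is_formal_inverse n f x)"

definition legendre :: "nat \<Rightarrow> 'a::comm_ring_1 mpoly \<Rightarrow> 'a mfps" where
  "legendre n f = dual_vars n f \<bullet> formal_inverse n f
     - mp_eval mfps_const (formal_inverse n f) f"

definition Hessian_conjecture :: "'a::field itself \<Rightarrow> nat \<Rightarrow> bool" where
  "Hessian_conjecture _ n \<longleftrightarrow>
     (\<forall>f :: 'a mpoly. f \<in> mpolys n \<longrightarrow>
        (\<exists>c. c \<noteq> 0 \<and> det (Hess n f) = mp_const c) \<longrightarrow>
        is_polynomial (legendre n f))"


section \<open>The polynomial\<close>

definition phi :: "'a::comm_ring_1 mpoly" where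
  "phi = (let
     x1 = mp_var 0; x2 = mp_var 1; x3 = mp_var 2;
     y1 = mp_var 3; y2 = mp_var 4; y3 = mp_var 5;
     u = 1 + x1 * x2
   in y1 * (u ^ 3 * x3 + x2 ^ 2 * u * (4 + 3 * x1 * x2))
    + y2 * (x2 + 3 * x1 * u ^ 2 * x3 + 3 * x1 * x2 ^ 2 * (4 + 3 * x1 * x2))
    + y3 * (2 * x1 - 3 * x1 ^ 2 * x2 - x1 ^ 3 * x3))"

end

theory Submission
  imports Defs "HOL-Computational_Algebra.Polynomial"
begin

text \<open>
  Write \<open>\<phi> = y\<^sub>1 F\<^sub>1(x) + y\<^sub>2 F\<^sub>2(x) + y\<^sub>3 F\<^sub>3(x)\<close>, with Jacobian matrix \<open>J\<close> of \<open>F = (F\<^sub>1, F\<^sub>2, F\<^sub>3)\<close>. The gradient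
  of \<open>\<phi>\<close> is \<open>(J\<^sup>T y, F(x))\<close>, so its Hessian has the form \<open>(A, J\<^sup>T; J, 0)\<close> with blocks of size three.
  Its determinant is therefore \<open>- (det J)\<^sup>2\<close> (\<open>det_zero_block\<close>), and \<open>det J = - 2\<close> by computation.
  The map \<open>F\<close> takes the same value at \<open>(1, - 1/2, - 5/2)\<close> and \<open>(3, - 1/2, 1/2)\<close>; hence \<open>\<nabla>\<phi>\<close> takes
  the same value at these points with \<open>y = 0\<close>.

  For the Legendre transform let \<open>(x, y)\<close> be the formal inverse of \<open>\<nabla>\<phi>\<close>; it exists and is unique because
  the Hessian at the origin is invertible (\<open>formal_inverse_exists_unique\<close>). Let \<open>a\<close> and \<open>b\<close> denote
  the dual variables of \<open>x\<close> and \<open>y\<close>. Since \<open>F(x) = b\<close>, the terms \<open>\<langle>b, y\<rangle>\<close> and \<open>\<phi>(x, y)\<close> cancel and the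
  transform is \<open>a\<^sub>1 x\<^sub>1 + a\<^sub>2 x\<^sub>2 + a\<^sub>3 x\<^sub>3\<close>. If it were a polynomial, then the parts of \<open>x\<^sub>1, x\<^sub>2, x\<^sub>3\<close> that
  involve only \<open>b\<^sub>1\<close> and \<open>b\<^sub>3\<close> would be polynomials, and they would solve \<open>F = (b\<^sub>1, 0, b\<^sub>3)\<close>. Setting
  \<open>b\<^sub>1 = t\<close> and \<open>b\<^sub>3 = 1\<close> gives univariate polynomials \<open>q\<close> with \<open>F(q) = (t, 0, 1)\<close>. But a
  certain polynomial in \<open>x\<close> satisfies a cubic equation whose coefficients depend only on \<open>F(x)\<close>
  (\<open>F_root_cubic\<close>). At \<open>q\<close> it reads \<open>r\<^sup>2 (r - 2) = 2 t\<close>, and comparing degrees shows that no polynomial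
  \<open>r\<close> satisfies it (\<open>no_polynomial_preimage\<close>).
\<close>

section \<open>Evaluation and derivatives of polynomials\<close>

text \<open>Identities that are additive in a polynomial need to be checked on monomials only.\<close>

lemma mpolys_induct [consumes 1, case_names single add]:
  fixes f :: "'a::comm_ring_1 mpoly"
  assumes f: "f \<in> mpolys n"
    and single: "\<And>m c. Poly_Mapping.keys m \<subseteq> {..<n} \<Longrightarrow> P (Poly_Mapping.single m c)"
    and add: "\<And>f g. P f \<Longrightarrow> P g \<Longrightarrow> P (f + g)"
  shows "P f"
proof -
  let ?s = "\<lambda>A. \<Sum>m\<in>A. Poly_Mapping.single m (Poly_Mapping.lookup f m)"
  have "P (?s A)" if "A \<subseteq> Poly_Mapping.keys f" for A
    using finite_subset[OF that finite_keys] that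
  proof (induction A)
    case empty
    have "P (Poly_Mapping.single 0 0)" by (rule single) simp
    then show ?case by simp
  next
    case (insert m A)
    then show ?case using f by (auto intro!: add single simp: mpolys_def)
  qed
  then have "P (?s (Poly_Mapping.keys f))" by blast
  moreover have "?s (Poly_Mapping.keys f) = f"
    by (rule poly_mapping_eqI)
      (auto simp: lookup_sum lookup_single when_def in_keys_iff)
  ultimately show ?thesis by simp
qed

lemma mpoly_induct [case_names single add]:
  fixes f :: "'a::comm_ring_1 mpoly"
  assumes single: "\<And>m c. P (Poly_Mapping.single m c)"
    and add: "\<And>f g. P f \<Longrightarrow> P g \<Longrightarrow> P (f + g)"
  shows "P f"
proof -
  have "finite (\<Union>(Poly_Mapping.keys ` Poly_Mapping.keys f))" by simp
  then obtain n where "\<Union>(Poly_Mapping.keys ` Poly_Mapping.keys f) \<subseteq> {..<n}"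
    by (metis finite_nat_iff_bounded)
  then have "f \<in> mpolys n" by (auto simp: mpolys_def)
  then show ?thesis by (induction rule: mpolys_induct) (auto intro: assms)
qed

definition mp_monom :: "'b::comm_ring_1 vec \<Rightarrow> monomial \<Rightarrow> 'b" where
  "mp_monom x m = (\<Prod>i \<in> Poly_Mapping.keys m. (x $ i) ^ Poly_Mapping.lookup m i)"

lemma mp_monom_superset:
  assumes "finite A" "Poly_Mapping.keys m \<subseteq> A"
  shows "mp_monom x m = (\<Prod>i \<in> A. (x $ i) ^ Poly_Mapping.lookup m i)"
  unfolding mp_monom_def
  by (rule prod.mono_neutral_left) (use assms in \<open>auto simp: in_keys_iff\<close>)

lemma mp_monom_add: "mp_monom x (a + b) = mp_monom x a * mp_monom x b"
proof -
  let ?A = "Poly_Mapping.keys a \<union> Poly_Mapping.keys b"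
  have "mp_monom x (a + b) = (\<Prod>i \<in> ?A. (x $ i) ^ Poly_Mapping.lookup (a + b) i)"
    by (rule mp_monom_superset) (use keys_add[of a b] in auto)
  also have "\<dots> = (\<Prod>i \<in> ?A. (x $ i) ^ Poly_Mapping.lookup a i)
      * (\<Prod>i \<in> ?A. (x $ i) ^ Poly_Mapping.lookup b i)"
    by (simp add: lookup_add power_add prod.distrib)
  also have "\<dots> = mp_monom x a * mp_monom x b"
    by (simp add: mp_monom_superset[of ?A])
  finally show ?thesis .
qed

lemma mp_monom_0 [simp]: "mp_monom x 0 = 1"
  by (simp add: mp_monom_def)

lemma mp_monom_single_1 [simp]: "mp_monom x (Poly_Mapping.single i (Suc 0)) = x $ i"
  by (simp add: mp_monom_def)

lemma monomial_split:
  assumes "i \<in> Poly_Mapping.keys (m :: monomial)"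
  shows "m = Poly_Mapping.single i 1 + (m - Poly_Mapping.single i 1)"
  by (rule poly_mapping_eqI)
    (use assms in \<open>auto simp: lookup_add lookup_minus lookup_single when_def in_keys_iff\<close>)

context comm_ring_hom
begin

lemma mp_eval_add: "mp_eval hom x (f + g) = mp_eval hom x f + mp_eval hom x g"
  unfolding mp_eval_def
  by (rule setsum_keys_plus_distrib) (simp_all add: hom_add distrib_right)

lemma mp_eval_single [simp]: "mp_eval hom x (Poly_Mapping.single m c) = hom c * mp_monom x m"
  by (simp add: mp_eval_def mp_monom_def)

lemma mp_eval_mult: "mp_eval hom x (f * g) = mp_eval hom x f * mp_eval hom x g"
proof (induction f rule: mpoly_induct)
  case (single a c)
  show ?case
    by (induction g rule: mpoly_induct)
      (simp_all add: mult_single mp_monom_add hom_mult distrib_left distrib_right mp_eval_add mult_ac)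
qed (simp add: distrib_right mp_eval_add)

lemma comm_ring_hom_mp_eval: "comm_ring_hom (mp_eval hom x)"
proof
  show "mp_eval hom x 1 = 1"
    using mp_eval_single[of x 0 1] by simp
  show "mp_eval hom x 0 = 0"
    by (simp add: mp_eval_def)
qed (rule mp_eval_add mp_eval_mult)+

lemma mp_eval_var [simp]: "mp_eval hom x (mp_var i) = x $ i"
  by (simp add: mp_var_def)

end

lemma comm_ring_hom_id: "comm_ring_hom (\<lambda>c :: 'a::comm_ring_1. c)"
  by standard auto

lemma mp_deriv_single:
  "mp_deriv i (Poly_Mapping.single m c)
    = Poly_Mapping.single (m - Poly_Mapping.single i 1) (of_nat (Poly_Mapping.lookup m i) * c)"
  by (simp add: mp_deriv_def)

lemma mp_deriv_add: "mp_deriv i (f + g) = mp_deriv i f + mp_deriv i g"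
  unfolding mp_deriv_def
  by (rule setsum_keys_plus_distrib) (simp_all add: distrib_left single_add)

lemma mp_deriv_mult: "mp_deriv i (f * g) = mp_deriv i f * g + f * mp_deriv i g"
proof (induction f rule: mpoly_induct)
  case (single a c)
  show ?case
  proof (induction g rule: mpoly_induct)
    case (single b d)
    have *: "a - Poly_Mapping.single i 1 + b = a + b - Poly_Mapping.single i 1"
      if "Poly_Mapping.lookup a i \<noteq> 0" for a b :: monomial
      using that by (intro poly_mapping_eqI)
        (auto simp: lookup_add lookup_minus lookup_single when_def)
    let ?e = "Poly_Mapping.single i (1::nat)"
    have left: "mp_deriv i (Poly_Mapping.single a c) * Poly_Mapping.single b d
        = Poly_Mapping.single (a + b - ?e) (of_nat (Poly_Mapping.lookup a i) * c * d)"
      using *[of a b]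
      by (cases "Poly_Mapping.lookup a i = 0") (simp_all add: mp_deriv_single mult_single)
    have right: "Poly_Mapping.single a c * mp_deriv i (Poly_Mapping.single b d)
        = Poly_Mapping.single (a + b - ?e) (c * (of_nat (Poly_Mapping.lookup b i) * d))"
      using *[of b a]
      by (cases "Poly_Mapping.lookup b i = 0")
        (simp_all add: mp_deriv_single mult_single add.commute)
    show ?case
      unfolding left right
      by (simp add: mp_deriv_single mult_single lookup_add single_add[symmetric] algebra_simps)
  qed (simp add: distrib_left mp_deriv_add algebra_simps)
qed (simp add: distrib_right mp_deriv_add algebra_simps)

lemma mp_deriv_commute: "mp_deriv i (mp_deriv j f) = mp_deriv j (mp_deriv i f)"
proof (induction f rule: mpoly_induct)
  case (single m c)
  have "m - Poly_Mapping.single j 1 - Poly_Mapping.single i 1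
      = m - Poly_Mapping.single i 1 - Poly_Mapping.single j (1::nat)"
    by (rule poly_mapping_eqI) (simp add: lookup_minus)
  then show ?case
    by (cases "i = j") (simp_all add: mp_deriv_single lookup_minus lookup_single mult_ac)
qed (simp add: mp_deriv_add)

lemma mpolys_add:
  assumes "f \<in> mpolys n" "g \<in> mpolys n"
  shows "f + g \<in> mpolys n"
  using assms keys_add[of f g] unfolding mpolys_def by blast

lemma single_in_mpolys:
  assumes "Poly_Mapping.keys m \<subseteq> {..<n}"
  shows "Poly_Mapping.single m c \<in> mpolys n"
  unfolding mpolys_def keys_single using assms by simp

lemma mp_deriv_in_mpolys:
  assumes "f \<in> mpolys n"
  shows "mp_deriv i f \<in> mpolys n"
  using assms
proof (induction rule: mpolys_induct)
  case (single m c)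
  have "Poly_Mapping.keys (m - Poly_Mapping.single i 1) \<subseteq> Poly_Mapping.keys m"
    by (auto simp: in_keys_iff lookup_minus)
  then have "Poly_Mapping.keys (m - Poly_Mapping.single i 1) \<subseteq> {..<n}"
    using single by (rule subset_trans)
  then show ?case
    unfolding mp_deriv_single by (rule single_in_mpolys)
qed (simp add: mp_deriv_add mpolys_add)

lemma comm_ring_hom_lookup_0:
  "comm_ring_hom (\<lambda>f :: 'a::comm_ring_1 mpoly. Poly_Mapping.lookup f 0)"
proof
  have zero_iff: "0 = a + b \<longleftrightarrow> a = 0 \<and> b = 0" "a + b = 0 \<longleftrightarrow> a = 0 \<and> b = 0" for a b :: monomial
    by (auto simp: poly_mapping_eq_iff lookup_add fun_eq_iff)
  show "Poly_Mapping.lookup (f * g) 0 = Poly_Mapping.lookup f 0 * Poly_Mapping.lookup g 0"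
    for f g :: "'a mpoly"
  proof (induction f rule: mpoly_induct)
    case (single a c)
    show ?case
      by (induction g rule: mpoly_induct)
        (auto simp: mult_single lookup_single when_def distrib_left lookup_add zero_iff)
  qed (simp add: distrib_right lookup_add)
qed (simp_all add: lookup_add)

lemma lookup_mp_deriv_0:
  "Poly_Mapping.lookup (mp_deriv i f) 0 = Poly_Mapping.lookup f (Poly_Mapping.single i 1)"
proof (induction f rule: mpoly_induct)
  case (single m c)
  show ?case
  proof (cases "m = Poly_Mapping.single i 1")
    case False
    have "m - Poly_Mapping.single i 1 \<noteq> 0" if "Poly_Mapping.lookup m i \<noteq> 0"
      using monomial_split[of i m] that False by (auto simp: in_keys_iff)
    with False show ?thesis
      by (cases "Poly_Mapping.lookup m i = 0") (simp_all add: mp_deriv_single lookup_single when_def)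
  qed (simp add: mp_deriv_single)
qed (simp add: mp_deriv_add lookup_add)

lemma mp_monom_zero_vec:
  assumes "Poly_Mapping.keys m \<subseteq> {..<n}" "m \<noteq> 0"
  shows "mp_monom (0\<^sub>v n) m = (0 :: 'b::comm_ring_1)"
proof -
  obtain i where i: "i \<in> Poly_Mapping.keys m"
    using assms(2) by (metis all_not_in_conv keys_eq_empty)
  then have "i < n" using assms(1) by blast
  with i have "(0\<^sub>v n $ i) ^ Poly_Mapping.lookup m i = (0 :: 'b)"
    by (simp add: in_keys_iff power_0_left)
  with i show ?thesis
    unfolding mp_monom_def by (intro prod_zero) auto
qed

lemma (in comm_ring_hom) mp_eval_zero_vec:
  assumes "f \<in> mpolys n"
  shows "mp_eval hom (0\<^sub>v n) f = hom (Poly_Mapping.lookup f 0)"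
  using assms
proof (induction rule: mpolys_induct)
  case (single m c)
  then show ?case
    by (cases "m = 0") (simp_all add: mp_monom_zero_vec lookup_single)
qed (simp add: mp_eval_add lookup_add hom_add)

lemma mp_deriv_var: "mp_deriv i (mp_var j) = (if i = j then 1 else 0)"
  by (simp add: mp_var_def mp_deriv_single lookup_single)

lemma mp_deriv_1 [simp]: "mp_deriv i 1 = 0"
  using mp_deriv_single[of i 0 1] by simp

lemma mp_deriv_numeral [simp]: "mp_deriv i (numeral k) = 0"
  using mp_deriv_single[of i 0 "numeral k"] by simp

lemma mp_deriv_diff: "mp_deriv i (f - g) = mp_deriv i f - mp_deriv i g"
  using mp_deriv_add[of i "f - g" g] by (simp add: algebra_simps)

lemma mp_deriv_power: "mp_deriv i (f ^ k) = of_nat k * f ^ (k - 1) * mp_deriv i f"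
proof (induction k)
  case (Suc k)
  then show ?case
    by (cases k) (simp_all add: mp_deriv_mult algebra_simps)
qed simp

lemmas mp_deriv_rules = mp_deriv_add mp_deriv_diff mp_deriv_mult mp_deriv_power mp_deriv_var

lemma mpolys_mult:
  fixes f g :: "'a::comm_ring_1 mpoly"
  assumes "f \<in> mpolys n" "g \<in> mpolys n"
  shows "f * g \<in> mpolys n"
  unfolding mpolys_def
proof (intro CollectI ballI)
  fix m assume "m \<in> Poly_Mapping.keys (f * g)"
  then obtain a b where m: "m = a + b"
    and ab: "a \<in> Poly_Mapping.keys f" "b \<in> Poly_Mapping.keys g"
    using keys_mult[of f g] by blast
  have "Poly_Mapping.keys a \<subseteq> {..<n}" "Poly_Mapping.keys b \<subseteq> {..<n}"
    using assms ab unfolding mpolys_def by simp_all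
  then show "Poly_Mapping.keys m \<subseteq> {..<n}"
    unfolding m using keys_add[of a b] by (meson Un_least subset_trans)
qed

lemma mpolys_power: "f \<in> mpolys n \<Longrightarrow> f ^ k \<in> mpolys n" for f :: "'a::comm_ring_1 mpoly"
  by (induction k) (simp_all add: mpolys_mult, simp add: mpolys_def)

lemma mpolys_uminus: "f \<in> mpolys n \<Longrightarrow> - f \<in> mpolys n" for f :: "'a::comm_ring_1 mpoly"
  by (simp add: mpolys_def in_keys_iff)

lemma mpolys_diff: "f \<in> mpolys n \<Longrightarrow> g \<in> mpolys n \<Longrightarrow> f - g \<in> mpolys n"
  for f g :: "'a::comm_ring_1 mpoly"
  using mpolys_add[OF _ mpolys_uminus, of f n g] by simp

lemma mpolys_1: "(1 :: 'a::comm_ring_1 mpoly) \<in> mpolys n"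
  using single_in_mpolys[of 0 n "1 :: 'a"] by simp

lemma mpolys_numeral: "(numeral k :: 'a::comm_ring_1 mpoly) \<in> mpolys n"
  using single_in_mpolys[of 0 n "numeral k :: 'a"] by simp

lemma mpolys_var: "i < n \<Longrightarrow> mp_var i \<in> mpolys n"
  unfolding mp_var_def by (rule single_in_mpolys) simp

section \<open>The degree filtration on power series\<close>

definition mdeg :: "monomial \<Rightarrow> nat" where
  "mdeg m = (\<Sum>i \<in> Poly_Mapping.keys m. Poly_Mapping.lookup m i)"

lemma mdeg_add: "mdeg (a + b) = mdeg a + mdeg b"
  unfolding mdeg_def by (rule setsum_keys_plus_distrib) simp_all

lemma mdeg_eq_0_iff: "mdeg m = 0 \<longleftrightarrow> m = 0"
  by (auto simp: mdeg_def in_keys_iff poly_mapping_eq_iff fun_eq_iff)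

lemma single_1_eq_iff [simp]:
  "Poly_Mapping.single i (Suc 0) = Poly_Mapping.single j (Suc 0) \<longleftrightarrow> i = j"
  by (metis keys_single nat.distinct(1) singleton_inject)

lemma single_1_neq_0 [simp]: "Poly_Mapping.single i (Suc 0) \<noteq> 0"
  by (metis keys_eq_empty keys_single insert_not_empty nat.distinct(1))

lemmas zero_neq_single_1 [simp] = single_1_neq_0[symmetric]

lemma mfps_coeff_0 [simp]: "mfps_coeff 0 m = 0"
  by (simp add: zero_mfps_def)

lemma mfps_coeff_add [simp]: "mfps_coeff (f + g) m = mfps_coeff f m + mfps_coeff g m"
  by (simp add: plus_mfps_def)

lemma mfps_coeff_diff [simp]: "mfps_coeff (f - g) m = mfps_coeff f m - mfps_coeff g m"
  by (simp add: minus_mfps_def)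

lemma mfps_coeff_uminus [simp]: "mfps_coeff (- f) m = - mfps_coeff f m"
  by (simp add: uminus_mfps_def)

lemma mfps_coeff_mult:
  "mfps_coeff (f * g) m = (\<Sum>(a, b) \<in> splits m. mfps_coeff f a * mfps_coeff g b)"
  by (simp add: times_mfps_def)

lemma mfps_coeff_sum: "mfps_coeff (\<Sum>i\<in>A. f i) m = (\<Sum>i\<in>A. mfps_coeff (f i) m)"
  by (induction A rule: infinite_finite_induct) simp_all

lemma mfps_coeff_const_mult [simp]:
  "mfps_coeff (mfps_const c * f) m = c * mfps_coeff f m"
proof -
  have "(\<Sum>(a, b) \<in> splits m. mfps_coeff (mfps_const c) a * mfps_coeff f b)
      = (\<Sum>(a, b) \<in> {(0, m)}. mfps_coeff (mfps_const c) a * mfps_coeff f b)"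
    by (rule sum.mono_neutral_right, simp) (auto simp: splits_def mfps_const_def split: if_splits)
  then show ?thesis
    by (simp add: mfps_coeff_mult mfps_const_def)
qed

lemma mfps_coeff_const [simp]: "mfps_coeff (mfps_const c) m = (if m = 0 then c else 0)"
  by (simp add: mfps_const_def)

lemma comm_ring_hom_mfps_const: "comm_ring_hom (mfps_const :: 'a::comm_ring_1 \<Rightarrow> 'a mfps)"
proof
  show "mfps_const (c * d) = mfps_const c * mfps_const d" for c d :: 'a
    unfolding mfps_eq_iff by simp
qed (simp_all add: mfps_eq_iff one_mfps_def)

text \<open>The filtration by order. It defines the topology in which the formal inverse is constructed as
  a limit.\<close>

definition vanishes_below :: "nat \<Rightarrow> 'a::zero mfps \<Rightarrow> bool" where
  "vanishes_below k f \<longleftrightarrow> (\<forall>m. mdeg m < k \<longrightarrow> mfps_coeff f m = 0)"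

lemma vanishes_below_0 [simp]: "vanishes_below 0 f"
  by (simp add: vanishes_below_def)

lemma zero_vanishes_below [simp]: "vanishes_below k 0"
  by (simp add: vanishes_below_def)

lemma vanishes_below_1_iff: "vanishes_below 1 f \<longleftrightarrow> mfps_coeff f 0 = 0"
  by (auto simp: vanishes_below_def mdeg_eq_0_iff)

lemma vanishes_below_antimono: "vanishes_below k f \<Longrightarrow> j \<le> k \<Longrightarrow> vanishes_below j f"
  by (auto simp: vanishes_below_def)

lemma vanishes_below_add:
  "vanishes_below k f \<Longrightarrow> vanishes_below k g \<Longrightarrow> vanishes_below k (f + g)"
  for f g :: "'a::comm_ring_1 mfps"
  by (simp add: vanishes_below_def)

lemma vanishes_below_diff:
  "vanishes_below k f \<Longrightarrow> vanishes_below k g \<Longrightarrow> vanishes_below k (f - g)"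
  for f g :: "'a::comm_ring_1 mfps"
  by (simp add: vanishes_below_def)

lemma vanishes_below_sum:
  fixes f :: "'i \<Rightarrow> 'a::comm_ring_1 mfps"
  shows "(\<And>i. i \<in> A \<Longrightarrow> vanishes_below k (f i)) \<Longrightarrow> vanishes_below k (\<Sum>i\<in>A. f i)"
  by (induction A rule: infinite_finite_induct) (simp_all add: vanishes_below_add)

lemma vanishes_below_const_mult:
  "vanishes_below k f \<Longrightarrow> vanishes_below k (mfps_const c * f)" for f :: "'a::comm_ring_1 mfps"
  by (simp add: vanishes_below_def)

lemma vanishes_below_mult:
  fixes f g :: "'a::comm_ring_1 mfps"
  assumes "vanishes_below j f" "vanishes_below k g"
  shows "vanishes_below (j + k) (f * g)"
  unfolding vanishes_below_def
proof (intro allI impI)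
  fix m assume m: "mdeg m < j + k"
  have "mfps_coeff f a * mfps_coeff g b = 0" if "(a, b) \<in> splits m" for a b
  proof -
    have "mdeg a < j \<or> mdeg b < k"
      using that m mdeg_add[of a b] by (auto simp: splits_def)
    then show ?thesis using assms by (auto simp: vanishes_below_def)
  qed
  then show "mfps_coeff (f * g) m = 0"
    unfolding mfps_coeff_mult by (intro sum.neutral) auto
qed

text \<open>The filtration is separated, which makes the formal inverse unique.\<close>

lemma eq_if_vanishes_below:
  fixes f g :: "'a::comm_ring_1 mfps"
  assumes "\<And>k. vanishes_below k (f - g)"
  shows "f = g"
proof -
  have "mfps_coeff f m = mfps_coeff g m" for m
    using assms[of "Suc (mdeg m)"] by (simp add: vanishes_below_def)
  then show ?thesis by (simp add: mfps_eq_iff)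
qed

text \<open>The filtration is complete. Consecutive terms differ ever later, so the coefficient at \<open>m\<close>
  is constant from the term with index \<open>Suc (mdeg m)\<close> on; the limit collects these values.\<close>

lemma mfps_limit:
  fixes X :: "nat \<Rightarrow> 'a::comm_ring_1 mfps"
  assumes step: "\<And>k. vanishes_below k (X (Suc k) - X k)"
  shows "\<exists>x. \<forall>k. vanishes_below k (x - X k)"
proof (intro exI allI)
  fix k
  have stable: "mfps_coeff (X (j + d)) m = mfps_coeff (X j) m" if "mdeg m < j" for m j d
  proof (induction d)
    case (Suc d)
    then show ?case using step[of "j + d"] that by (simp add: vanishes_below_def)
  qed simp
  show "vanishes_below k (Mfps (\<lambda>m. mfps_coeff (X (Suc (mdeg m))) m) - X k)"
    unfolding vanishes_below_def
  proof (intro allI impI)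
    fix m assume "mdeg m < k"
    then have "X k = X (Suc (mdeg m) + (k - Suc (mdeg m)))" by simp
    then have "mfps_coeff (X k) m = mfps_coeff (X (Suc (mdeg m))) m"
      using stable[of m "Suc (mdeg m)"] by (metis lessI)
    then show "mfps_coeff (Mfps (\<lambda>m. mfps_coeff (X (Suc (mdeg m))) m) - X k) m = 0" by simp
  qed
qed

lemma mfps_in_add: "f \<in> mfps_in n \<Longrightarrow> g \<in> mfps_in n \<Longrightarrow> f + g \<in> mfps_in n"
  for f g :: "'a::comm_ring_1 mfps"
  unfolding mfps_in_def by (auto, metis add.right_neutral lessThan_iff subsetD)

lemma mfps_in_diff: "f \<in> mfps_in n \<Longrightarrow> g \<in> mfps_in n \<Longrightarrow> f - g \<in> mfps_in n"
  for f g :: "'a::comm_ring_1 mfps"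
  unfolding mfps_in_def by (auto, metis diff_zero lessThan_iff subsetD)

lemma mfps_in_const [simp]: "mfps_const c \<in> mfps_in n"
  by (simp add: mfps_in_def mfps_const_def)

lemma mfps_in_0 [simp]: "0 \<in> mfps_in n"
  by (simp add: mfps_in_def)

lemma mfps_in_1 [simp]: "1 \<in> mfps_in n"
  by (simp add: mfps_in_def one_mfps_def)

lemma mfps_in_var: "i < n \<Longrightarrow> mfps_var i \<in> mfps_in n"
  by (simp add: mfps_in_def mfps_var_def)

lemma mfps_in_mult:
  fixes f g :: "'a::comm_ring_1 mfps"
  assumes "f \<in> mfps_in n" "g \<in> mfps_in n"
  shows "f * g \<in> mfps_in n"
  unfolding mfps_in_def
proof (intro CollectI allI impI)
  fix m assume "mfps_coeff (f * g) m \<noteq> 0"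
  then obtain a b where "(a, b) \<in> splits m" "mfps_coeff f a * mfps_coeff g b \<noteq> 0"
    unfolding mfps_coeff_mult by (metis (mono_tags, lifting) old.prod.exhaust split_conv sum.neutral)
  then have "a + b = m" "mfps_coeff f a \<noteq> 0" "mfps_coeff g b \<noteq> 0"
    by (auto simp: splits_def)
  with assms keys_add[of a b] show "Poly_Mapping.keys m \<subseteq> {..<n}"
    unfolding mfps_in_def by blast
qed

lemma mfps_in_sum: "(\<And>i. i \<in> A \<Longrightarrow> f i \<in> mfps_in n) \<Longrightarrow> (\<Sum>i\<in>A. f i) \<in> mfps_in n"
  for f :: "'i \<Rightarrow> 'a::comm_ring_1 mfps"
  by (induction A rule: infinite_finite_induct) (simp_all add: mfps_in_add)

lemma mfps_in_power: "f \<in> mfps_in n \<Longrightarrow> f ^ k \<in> mfps_in n" for f :: "'a::comm_ring_1 mfps"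
  by (induction k) (simp_all add: mfps_in_mult)

lemma mfps_in_prod: "(\<And>i. i \<in> A \<Longrightarrow> f i \<in> mfps_in n) \<Longrightarrow> (\<Prod>i\<in>A. f i) \<in> mfps_in n"
  for f :: "'i \<Rightarrow> 'a::comm_ring_1 mfps"
  by (induction A rule: infinite_finite_induct) (simp_all add: mfps_in_mult)

lemma mfps_in_mp_eval:
  fixes f :: "'a::comm_ring_1 mpoly"
  assumes "f \<in> mpolys n" "\<And>i. i < n \<Longrightarrow> x $ i \<in> mfps_in n"
  shows "mp_eval mfps_const x f \<in> mfps_in n"
  unfolding mp_eval_def
proof (intro mfps_in_sum mfps_in_mult mfps_in_const mfps_in_prod mfps_in_power)
  fix m i assume "m \<in> Poly_Mapping.keys f" "i \<in> Poly_Mapping.keys m"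
  with assms(1) have "i < n" unfolding mpolys_def by blast
  then show "x $ i \<in> mfps_in n" by (rule assms(2))
qed

lemma mfps_in_limit:
  fixes x :: "'a::comm_ring_1 mfps"
  assumes "\<And>k. X k \<in> mfps_in n" "\<And>k. vanishes_below k (x - X k)"
  shows "x \<in> mfps_in n"
  unfolding mfps_in_def
proof (intro CollectI allI impI)
  fix m assume "mfps_coeff x m \<noteq> 0"
  moreover have "mfps_coeff (x - X (Suc (mdeg m))) m = 0"
    using assms(2)[of "Suc (mdeg m)"] by (simp add: vanishes_below_def)
  ultimately have "mfps_coeff (X (Suc (mdeg m))) m \<noteq> 0" by simp
  with assms(1) show "Poly_Mapping.keys m \<subseteq> {..<n}"
    unfolding mfps_in_def by blast
qed

section \<open>Existence and uniqueness of the formal inverse\<close>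

text \<open>Every nonconstant monomial takes arguments without constant term to a series without
  constant term. In \<open>mp_eval_linearisation\<close> this is the source of the extra order gained by monomials of
  degree at least two.\<close>

lemma mp_monom_vanishes:
  fixes x :: "'a::comm_ring_1 mfps vec"
  assumes "Poly_Mapping.keys m \<subseteq> {..<n}" "m \<noteq> 0" "\<And>i. i < n \<Longrightarrow> vanishes_below 1 (x $ i)"
  shows "vanishes_below 1 (mp_monom x m)"
proof -
  obtain i where i: "i \<in> Poly_Mapping.keys m" using assms(2) by (metis all_not_in_conv keys_eq_empty)
  define m' where "m' = m - Poly_Mapping.single i 1"
  have "mp_monom x m = x $ i * mp_monom x m'"
    using monomial_split[OF i] mp_monom_add[of x "Poly_Mapping.single i 1" m']
    by (simp add: m'_def)
  moreover have "i < n" using i assms(1) by blast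
  ultimately show ?thesis
    using vanishes_below_mult[OF assms(3) vanishes_below_0, of i "mp_monom x m'"] by simp
qed

lemma mp_monom_diff_vanishes:
  fixes x y :: "'a::comm_ring_1 mfps vec"
  assumes "Poly_Mapping.keys m \<subseteq> {..<n}" "\<And>i. i < n \<Longrightarrow> vanishes_below k (x $ i - y $ i)"
  shows "vanishes_below k (mp_monom x m - mp_monom y m)"
  using assms(1)
proof (induction "mdeg m" arbitrary: m rule: less_induct)
  case less
  show ?case
  proof (cases "m = 0")
    case False
    then obtain i where i: "i \<in> Poly_Mapping.keys m" by (metis all_not_in_conv keys_eq_empty)
    define m' where "m' = m - Poly_Mapping.single i 1"
    have m: "m = Poly_Mapping.single i 1 + m'"
      using monomial_split[OF i] by (simp add: m'_def)
    have "mdeg m' < mdeg m"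
      using mdeg_add[of "Poly_Mapping.single i 1" m'] m mdeg_eq_0_iff[of "Poly_Mapping.single i (1::nat)"]
      by (simp add: mdeg_def)
    moreover have "Poly_Mapping.keys m' \<subseteq> Poly_Mapping.keys m"
      by (auto simp: m'_def in_keys_iff lookup_minus)
    ultimately have IH: "vanishes_below k (mp_monom x m' - mp_monom y m')"
      using less by blast
    have "i < n" using i less.prems by blast
    have "mp_monom x m - mp_monom y m
        = x $ i * (mp_monom x m' - mp_monom y m') + (x $ i - y $ i) * mp_monom y m'"
      unfolding m by (simp add: mp_monom_add algebra_simps)
    moreover have "vanishes_below k (x $ i * (mp_monom x m' - mp_monom y m'))"
      using vanishes_below_mult[OF vanishes_below_0 IH] by simp
    moreover have "vanishes_below k ((x $ i - y $ i) * mp_monom y m')"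
      using vanishes_below_mult[OF assms(2)[OF \<open>i < n\<close>] vanishes_below_0] by simp
    ultimately show ?thesis by (simp add: vanishes_below_add)
  qed simp
qed

text \<open>A polynomial behaves like its linear part up to one order beyond the difference of the
  arguments. For a monomial \<open>x\<^sub>i m\<close> with \<open>m\<close> nonconstant, write
  \<open>x\<^sub>i m(x) - y\<^sub>i m(y) = x\<^sub>i (m(x) - m(y)) + (x\<^sub>i - y\<^sub>i) m(y)\<close>: in each summand one factor has the order
  of the difference and the other has no constant term.\<close>

lemma mp_eval_linearisation:
  fixes f :: "'a::comm_ring_1 mpoly"
  assumes f: "f \<in> mpolys n"
    and x: "\<And>i. i < n \<Longrightarrow> vanishes_below 1 (x $ i)"
    and y: "\<And>i. i < n \<Longrightarrow> vanishes_below 1 (y $ i)"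
    and xy: "\<And>i. i < n \<Longrightarrow> vanishes_below k (x $ i - y $ i)"
  shows "vanishes_below (Suc k) (mp_eval mfps_const x f - mp_eval mfps_const y f
    - (\<Sum>i<n. mfps_const (Poly_Mapping.lookup f (Poly_Mapping.single i 1)) * (x $ i - y $ i)))"
  using f
proof (induction rule: mpolys_induct)
  case (single m c)
  interpret C: comm_ring_hom "mfps_const :: 'a \<Rightarrow> 'a mfps" by (rule comm_ring_hom_mfps_const)
  let ?lin = "\<Sum>i<n. mfps_const (Poly_Mapping.lookup (Poly_Mapping.single m c) (Poly_Mapping.single i 1))
    * (x $ i - y $ i)"
  show ?case
  proof (cases "m = 0")
    case True
    have "?lin = 0"
      using True by (simp add: lookup_single when_def)
    then show ?thesis using True by (simp add: C.mp_eval_single)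
  next
    case m0: False
    then obtain i where i: "i \<in> Poly_Mapping.keys m" by (metis all_not_in_conv keys_eq_empty)
    then have "i < n" using single by blast
    define m' where "m' = m - Poly_Mapping.single i 1"
    have m: "m = Poly_Mapping.single i 1 + m'"
      using monomial_split[OF i] by (simp add: m'_def)
    show ?thesis
    proof (cases "m' = 0")
      case True
      have "?lin = (\<Sum>j<n. if j = i then mfps_const c * (x $ i - y $ i) else 0)"
        unfolding m True by (intro sum.cong) (auto simp: lookup_single when_def)
      also have "\<dots> = mfps_const c * (x $ i - y $ i)"
        using \<open>i < n\<close> by simp
      finally show ?thesis
        unfolding m True by (simp add: C.mp_eval_single algebra_simps)
    next
      case False
      have "m \<noteq> Poly_Mapping.single j 1" for j
      proof
        assume "m = Poly_Mapping.single j 1"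
        then have "mdeg m = 1" by (simp add: mdeg_def)
        moreover have "mdeg m = 1 + mdeg m'"
          unfolding m mdeg_add by (simp add: mdeg_def)
        ultimately show False using False by (simp add: mdeg_eq_0_iff)
      qed
      then have lin: "?lin = 0"
        by (simp add: lookup_single when_def)
      have "Poly_Mapping.keys m' \<subseteq> Poly_Mapping.keys m"
        by (auto simp: m'_def in_keys_iff lookup_minus)
      then have keys: "Poly_Mapping.keys m' \<subseteq> {..<n}"
        using single by (rule subset_trans)
      have "mp_monom x m - mp_monom y m
          = x $ i * (mp_monom x m' - mp_monom y m') + (x $ i - y $ i) * mp_monom y m'"
        unfolding m by (simp add: mp_monom_add algebra_simps)
      moreover have "vanishes_below (Suc k) (x $ i * (mp_monom x m' - mp_monom y m'))"
        using vanishes_below_mult[OF x[OF \<open>i < n\<close>] mp_monom_diff_vanishes[OF keys xy]] by simp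
      moreover have "vanishes_below (Suc k) ((x $ i - y $ i) * mp_monom y m')"
        using vanishes_below_mult[OF xy[OF \<open>i < n\<close>] mp_monom_vanishes[OF keys False y]] by simp
      ultimately have "vanishes_below (Suc k) (mfps_const c * (mp_monom x m - mp_monom y m))"
        by (simp add: vanishes_below_add vanishes_below_const_mult)
      then show ?thesis
        unfolding lin by (simp add: C.mp_eval_single right_diff_distrib)
    qed
  qed
next
  case (add f g)
  interpret C: comm_ring_hom "mfps_const :: 'a \<Rightarrow> 'a mfps" by (rule comm_ring_hom_mfps_const)
  show ?case
    using vanishes_below_add[OF add]
    unfolding C.mp_eval_add lookup_add C.hom_add distrib_right sum.distrib add_diff_add .
qed

text \<open>This is Newton iteration with a fixed derivative. Let \<open>H\<close> be the Hessian at the origin and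
  \<open>B = H\<^bsup>-1\<^esup>\<close>. The solutions of \<open>\<nabla>f(x) = p\<close> are the fixed points of \<open>T(x) = x - B (\<nabla>f(x) - p)\<close>. Since
  \<open>\<nabla>f\<close> agrees with \<open>H\<close> to first order, the linear terms cancel in \<open>T(x) - T(y)\<close>, so \<open>T\<close> raises the order of
  differences by one. Iteration from zero therefore converges to a fixed point, and there is only
  one.\<close>

lemma formal_inverse_exists_unique:
  fixes f :: "'a::field mpoly"
  assumes f: "f \<in> mpolys n" and det: "det (Hess n f) = mp_const c" and c: "c \<noteq> 0"
  shows "\<exists>!x. is_formal_inverse n f x"
proof -
  interpret C: comm_ring_hom "mfps_const :: 'a \<Rightarrow> 'a mfps" by (rule comm_ring_hom_mfps_const)
  interpret L: comm_ring_hom "\<lambda>g :: 'a mpoly. Poly_Mapping.lookup g 0"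
    by (rule comm_ring_hom_lookup_0)
  let ?g = "\<lambda>j. mp_deriv j f"
  have g: "?g j \<in> mpolys n" for j using f by (rule mp_deriv_in_mpolys)

  \<comment> \<open>The matrix of linear coefficients of the gradient is the Hessian at the origin.\<close>
  define H where "H = map_mat (\<lambda>g. Poly_Mapping.lookup g 0) (Hess n f)"
  have H: "H \<in> carrier_mat n n" by (simp add: H_def Hess_def)
  have H_index: "H $$ (i, j) = Poly_Mapping.lookup (?g i) (Poly_Mapping.single j 1)"
    if "i < n" "j < n" for i j
    using that mp_deriv_commute[of i j f] lookup_mp_deriv_0[of j "?g i"]
    by (simp add: H_def Hess_def)
  have "det H = c"
    unfolding H_def L.hom_det det by (simp add: mp_const_def)
  then have "H \<in> Units (ring_mat TYPE('a) n ())"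
    using det_non_zero_imp_unit[OF H, of "()"] c by simp
  then obtain B where B: "B \<in> carrier_mat n n" "B * H = 1\<^sub>m n" "H * B = 1\<^sub>m n"
    unfolding Units_def ring_mat_def by auto
  have BH: "(\<Sum>j<n. B $$ (i, j) * H $$ (j, l)) = (if i = l then 1 else 0)"
    if "i < n" "l < n" for i l
  proof -
    have "(B * H) $$ (i, l) = (\<Sum>j<n. B $$ (i, j) * H $$ (j, l))"
      using that B(1) H by (simp add: scalar_prod_def atLeast0LessThan)
    then show ?thesis using that by (simp add: B(2))
  qed
  have HB: "(\<Sum>j<n. H $$ (i, j) * B $$ (j, l)) = (if i = l then 1 else 0)"
    if "i < n" "l < n" for i l
  proof -
    have "(H * B) $$ (i, l) = (\<Sum>j<n. H $$ (i, j) * B $$ (j, l))"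
      using that B(1) H by (simp add: scalar_prod_def atLeast0LessThan)
    then show ?thesis using that by (simp add: B(3))
  qed

  define D where "D x j = mp_eval mfps_const x (?g j) - dual_vars n f $ j" for x j
  define T where "T x = vec n (\<lambda>i. x $ i - (\<Sum>j<n. mfps_const (B $$ (i, j)) * D x j))" for x
  have T_index: "T x $ i = x $ i - (\<Sum>j<n. mfps_const (B $$ (i, j)) * D x j)" if "i < n" for x i
    using that by (simp add: T_def)
  have dual: "dual_vars n f $ j = mfps_const (Poly_Mapping.lookup (?g j) 0) + mfps_var j"
    if "j < n" for j
    using that comm_ring_hom.mp_eval_zero_vec[OF comm_ring_hom_id g]
    by (simp add: dual_vars_def grad_map_def grad_def)

  have inverse_iff: "is_formal_inverse n f x \<longleftrightarrow> x \<in> carrier_vec n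
      \<and> (\<forall>i<n. x $ i \<in> mfps_in n \<and> vanishes_below 1 (x $ i)) \<and> (\<forall>j<n. D x j = 0)" for x
  proof -
    have "map_vec (mp_eval mfps_const x) (grad n f) = dual_vars n f \<longleftrightarrow> (\<forall>j<n. D x j = 0)"
      by (auto simp: D_def grad_def dual_vars_def vec_eq_iff)
    then show ?thesis
      unfolding is_formal_inverse_def vanishes_below_1_iff by blast
  qed

  have contraction: "vanishes_below (Suc k) (T x $ i - T y $ i)"
    if x: "\<And>i. i < n \<Longrightarrow> vanishes_below 1 (x $ i)"
      and y: "\<And>i. i < n \<Longrightarrow> vanishes_below 1 (y $ i)"
      and xy: "\<And>i. i < n \<Longrightarrow> vanishes_below k (x $ i - y $ i)" and i: "i < n" for x y k i
  proof -
    let ?R = "\<lambda>j. D x j - D y j - (\<Sum>l<n. mfps_const (H $$ (j, l)) * (x $ l - y $ l))"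
    have R: "vanishes_below (Suc k) (?R j)" if "j < n" for j
    proof -
      have "(\<Sum>l<n. mfps_const (Poly_Mapping.lookup (?g j) (Poly_Mapping.single l 1)) * (x $ l - y $ l))
          = (\<Sum>l<n. mfps_const (H $$ (j, l)) * (x $ l - y $ l))"
        using H_index[OF that] by (intro sum.cong) auto
      then show ?thesis
        using mp_eval_linearisation[OF g x y xy, of j] by (simp add: D_def)
    qed
    have "(\<Sum>j<n. mfps_const (B $$ (i, j)) * (\<Sum>l<n. mfps_const (H $$ (j, l)) * (x $ l - y $ l)))
        = (\<Sum>l<n. mfps_const (\<Sum>j<n. B $$ (i, j) * H $$ (j, l)) * (x $ l - y $ l))"
      unfolding sum_distrib_left C.hom_sum sum_distrib_right C.hom_mult mult.assoc
      by (rule sum.swap)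
    also have "\<dots> = (\<Sum>l<n. if i = l then x $ l - y $ l else 0)"
      using BH[OF i] by (intro sum.cong) auto
    also have "\<dots> = x $ i - y $ i"
      using i by simp
    finally have "T x $ i - T y $ i = - (\<Sum>j<n. mfps_const (B $$ (i, j)) * ?R j)"
      unfolding T_index[OF i] by (simp add: right_diff_distrib sum_subtractf)
    moreover have "vanishes_below (Suc k) (0 - (\<Sum>j<n. mfps_const (B $$ (i, j)) * ?R j))"
      by (rule vanishes_below_diff[OF zero_vanishes_below], rule vanishes_below_sum,
          rule vanishes_below_const_mult, rule R) simp
    ultimately show ?thesis by simp
  qed

  have fixpoint_iff: "(\<forall>i<n. T x $ i = x $ i) \<longleftrightarrow> (\<forall>j<n. D x j = 0)" for x
  proof
    assume fixed: "\<forall>i<n. T x $ i = x $ i"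
    show "\<forall>j<n. D x j = 0"
    proof (intro allI impI)
      fix l assume l: "l < n"
      have "(\<Sum>j<n. mfps_const (B $$ (i, j)) * D x j) = 0" if "i < n" for i
        using fixed T_index[OF that, of x] that by simp
      then have "0 = (\<Sum>i<n. mfps_const (H $$ (l, i)) * (\<Sum>j<n. mfps_const (B $$ (i, j)) * D x j))"
        by simp
      also have "\<dots> = (\<Sum>j<n. mfps_const (\<Sum>i<n. H $$ (l, i) * B $$ (i, j)) * D x j)"
        unfolding sum_distrib_left C.hom_sum sum_distrib_right C.hom_mult mult.assoc
        by (rule sum.swap)
      also have "\<dots> = (\<Sum>j<n. if l = j then D x j else 0)"
        using HB[OF l] by (intro sum.cong) auto
      finally show "D x l = 0" using l by simp
    qed
  qed (simp add: T_index)

  \<comment> \<open>The iteration stays among the vectors of series without constant term: \<open>dual_vars\<close> has the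
    constant term \<open>\<nabla>f(0)\<close>, so \<open>T\<close> sends zero to such a vector, and the contraction property transfers
    this to all others.\<close>
  have vanish_T: "vanishes_below 1 (T x $ i)"
    if x: "\<And>i. i < n \<Longrightarrow> vanishes_below 1 (x $ i)" and i: "i < n" for x i
  proof -
    have D0: "vanishes_below 1 (D (0\<^sub>v n) j)" if "j < n" for j
    proof -
      have "mp_eval mfps_const (0\<^sub>v n) (?g j) = mfps_const (Poly_Mapping.lookup (?g j) 0)"
        using g by (rule C.mp_eval_zero_vec)
      moreover have "vanishes_below 1 (mfps_var j :: 'a mfps)"
        unfolding vanishes_below_1_iff by (simp add: mfps_var_def)
      ultimately show ?thesis
        using dual[OF that] unfolding vanishes_below_1_iff by (simp add: D_def)
    qed
    have "vanishes_below 1 (T (0\<^sub>v n) $ i)"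
      unfolding T_index[OF i]
      using D0 i by (intro vanishes_below_diff vanishes_below_sum vanishes_below_const_mult) auto
    moreover have "vanishes_below 1 (T x $ i - T (0\<^sub>v n) $ i)"
      using contraction[of x "0\<^sub>v n" 0 i] x i by simp
    ultimately show ?thesis
      using vanishes_below_add by fastforce
  qed

  have in_T: "T x $ i \<in> mfps_in n"
    if "\<And>i. i < n \<Longrightarrow> x $ i \<in> mfps_in n" "i < n" for x i
    unfolding T_index[OF that(2)] D_def
    using that g dual
    by (auto intro!: mfps_in_diff mfps_in_sum mfps_in_mult mfps_in_mp_eval mfps_in_add mfps_in_var)

  define X where "X k = (T ^^ k) (0\<^sub>v n)" for k
  have X_Suc: "X (Suc k) = T (X k)" for k by (simp add: X_def)
  have X: "X k $ i \<in> mfps_in n \<and> vanishes_below 1 (X k $ i)" if "i < n" for k i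
    using that
  proof (induction k arbitrary: i)
    case 0
    then show ?case by (simp add: X_def)
  next
    case (Suc k)
    then show ?case unfolding X_Suc using in_T vanish_T by blast
  qed
  have "vanishes_below k (X (Suc k) $ i - X k $ i)" if "i < n" for k i
    using that
  proof (induction k arbitrary: i)
    case (Suc k)
    show ?case
      unfolding X_Suc[of "Suc k"] X_Suc[of k]
      by (rule contraction) (use Suc X in \<open>auto simp: X_Suc[symmetric]\<close>)
  qed simp
  then have "\<exists>x. \<forall>k. vanishes_below k (x - X k $ i)" if "i < n" for i
    using mfps_limit[of "\<lambda>k. X k $ i"] that by blast
  then obtain z where z: "\<And>i k. i < n \<Longrightarrow> vanishes_below k (z i - X k $ i)"
    by metis
  define x where "x = vec n z"
  have x_X: "vanishes_below k (x $ i - X k $ i)" if "i < n" for i k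
    using z that by (simp add: x_def)
  have x_in: "x $ i \<in> mfps_in n" if "i < n" for i
    using mfps_in_limit[of "\<lambda>k. X k $ i"] X x_X that by blast
  have x_1: "vanishes_below 1 (x $ i)" if "i < n" for i
    using vanishes_below_add[OF x_X[OF that, of 1] conjunct2[OF X[OF that, of 1]]] by simp
  have "T x $ i = x $ i" if i: "i < n" for i
  proof (rule eq_if_vanishes_below)
    fix k
    have "vanishes_below (Suc k) (T x $ i - T (X k) $ i)"
      using contraction x_1 X x_X i by blast
    then have "vanishes_below (Suc k) (T x $ i - X (Suc k) $ i - (x $ i - X (Suc k) $ i))"
      unfolding X_Suc[symmetric] using x_X[OF i] by (rule vanishes_below_diff)
    then show "vanishes_below k (T x $ i - x $ i)"
      by (auto intro: vanishes_below_antimono)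
  qed
  then have "\<forall>j<n. D x j = 0"
    using fixpoint_iff by blast
  moreover have "x \<in> carrier_vec n"
    by (simp add: x_def)
  ultimately have "is_formal_inverse n f x"
    unfolding inverse_iff using x_in x_1 by blast
  moreover have "y = x" if "is_formal_inverse n f x" "is_formal_inverse n f y" for x y
  proof -
    have fx: "x \<in> carrier_vec n" "\<And>i. i < n \<Longrightarrow> vanishes_below 1 (x $ i)"
        "\<And>i. i < n \<Longrightarrow> T x $ i = x $ i"
      and fy: "y \<in> carrier_vec n" "\<And>i. i < n \<Longrightarrow> vanishes_below 1 (y $ i)"
        "\<And>i. i < n \<Longrightarrow> T y $ i = y $ i"
      using that fixpoint_iff unfolding inverse_iff by blast+
    have "vanishes_below k (y $ i - x $ i)" if "i < n" for k i
      using that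
    proof (induction k arbitrary: i)
      case (Suc k)
      then show ?case
        using contraction[of y x k i] fx fy by simp
    qed simp
    then have "y $ i = x $ i" if "i < n" for i
      using eq_if_vanishes_below that by blast
    then show ?thesis using fx(1) fy(1) by (intro eq_vecI) auto
  qed
  ultimately show ?thesis by blast
qed

section \<open>Determinants of order three and of bordered shape\<close>

lemma det_2x2:
  fixes A :: "'a::comm_ring_1 mat"
  assumes "A \<in> carrier_mat 2 2"
  shows "det A = A $$ (0, 0) * A $$ (1, 1) - A $$ (1, 0) * A $$ (0, 1)"
proof -
  have "mat_delete A i j \<in> carrier_mat 1 1" for i j
    using assms mat_delete_carrier[of A 2 2 i j] by simp
  then have minor: "det (mat_delete A i j) = mat_delete A i j $$ (0, 0)" for i j
    by (rule det_single)
  show ?thesis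
    using assms unfolding laplace_expansion_column[OF assms zero_less_numeral] cofactor_def minor
    by (simp add: mat_delete_def numeral_eq_Suc)
qed

lemma det_3x3:
  fixes A :: "'a::comm_ring_1 mat"
  assumes "A \<in> carrier_mat 3 3"
  shows "det A = A $$ (0, 0) * (A $$ (1, 1) * A $$ (2, 2) - A $$ (2, 1) * A $$ (1, 2))
    - A $$ (1, 0) * (A $$ (0, 1) * A $$ (2, 2) - A $$ (2, 1) * A $$ (0, 2))
    + A $$ (2, 0) * (A $$ (0, 1) * A $$ (1, 2) - A $$ (1, 1) * A $$ (0, 2))"
proof -
  have "mat_delete A i j \<in> carrier_mat 2 2" for i j
    using assms mat_delete_carrier[of A 3 3 i j] by simp
  then have minor: "det (mat_delete A i j) = mat_delete A i j $$ (0, 0) * mat_delete A i j $$ (1, 1)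
      - mat_delete A i j $$ (1, 0) * mat_delete A i j $$ (0, 1)" for i j
    by (rule det_2x2)
  show ?thesis
    using assms unfolding laplace_expansion_column[OF assms zero_less_numeral] cofactor_def minor
    by (simp add: mat_delete_def numeral_eq_Suc algebra_simps)
qed

text \<open>The zero block commutes with \<open>J\<close>, so the block determinant formula reduces the claim to the
  determinant of \<open>- J\<^sup>T J\<close>.\<close>

lemma det_zero_block:
  fixes A J :: "'a::idom mat"
  assumes A: "A \<in> carrier_mat n n" and J: "J \<in> carrier_mat n n"
  shows "det (four_block_mat A (transpose_mat J) J (0\<^sub>m n n)) = (-1) ^ n * (det J)\<^sup>2"
proof -
  have JT: "transpose_mat J \<in> carrier_mat n n" using J by simp
  have "det (four_block_mat A (transpose_mat J) J (0\<^sub>m n n))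
      = det (A * 0\<^sub>m n n - transpose_mat J * J)"
    using J by (intro det_four_block_mat[OF A JT J]) auto
  also have "A * 0\<^sub>m n n - transpose_mat J * J = (-1) \<cdot>\<^sub>m (transpose_mat J * J)"
    using A J by (intro eq_matI) auto
  also have "det \<dots> = (-1) ^ n * (det J)\<^sup>2"
    using J JT by (simp add: det_smult det_mult[OF JT J] det_transpose[OF J] power2_eq_square)
  finally show ?thesis .
qed

section \<open>The polynomial map underlying the counterexample\<close>

text \<open>The three components are homogeneous of weights \<open>2\<close>, \<open>1\<close>, \<open>- 1\<close> when \<open>x\<^sub>1, x\<^sub>2, x\<^sub>3\<close> have weights
  \<open>- 1\<close>, \<open>1\<close>, \<open>2\<close>. They are functions on an arbitrary commutative ring because they are applied to
  scalars, power series, and polynomials in one and in several variables.\<close>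

definition F1 :: "'b::comm_ring_1 \<Rightarrow> 'b \<Rightarrow> 'b \<Rightarrow> 'b" where
  "F1 x1 x2 x3 = (1 + x1 * x2) ^ 3 * x3 + x2 ^ 2 * (1 + x1 * x2) * (4 + 3 * x1 * x2)"

definition F2 :: "'b::comm_ring_1 \<Rightarrow> 'b \<Rightarrow> 'b \<Rightarrow> 'b" where
  "F2 x1 x2 x3 = x2 + 3 * x1 * (1 + x1 * x2) ^ 2 * x3 + 3 * x1 * x2 ^ 2 * (4 + 3 * x1 * x2)"

definition F3 :: "'b::comm_ring_1 \<Rightarrow> 'b \<Rightarrow> 'b \<Rightarrow> 'b" where
  "F3 x1 x2 x3 = 2 * x1 - 3 * x1 ^ 2 * x2 - x1 ^ 3 * x3"

text \<open>A polynomial of weight zero. In terms of \<open>u = 1 + x\<^sub>1 x\<^sub>2\<close> it equals \<open>u s\<close>, where \<open>F\<^sub>3 = x\<^sub>1 s\<close>.\<close>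

definition F_root :: "'b::comm_ring_1 \<Rightarrow> 'b \<Rightarrow> 'b \<Rightarrow> 'b" where
  "F_root x1 x2 x3 = (1 + x1 * x2) * (2 - 3 * x1 * x2 - x1 ^ 2 * x3)"

text \<open>With \<open>s\<close> and \<open>u\<close> as above and \<open>r = u s\<close>, the products of weight zero are
  \<open>F\<^sub>2 F\<^sub>3 = 4 r + 2 s - 3 r\<^sup>2\<close> and \<open>F\<^sub>1 F\<^sub>3\<^sup>2 = r\<^sup>2 + r s - r\<^sup>3\<close>; eliminating \<open>s\<close> leaves this cubic
  equation for \<open>r\<close> with coefficients that depend only on the value of \<open>F\<close>.\<close>

lemma F_root_cubic:
  "F_root x1 x2 x3 ^ 3 - 2 * F_root x1 x2 x3 ^ 2 + F2 x1 x2 x3 * F3 x1 x2 x3 * F_root x1 x2 x3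
    - 2 * F1 x1 x2 x3 * F3 x1 x2 x3 ^ 2 = 0"
  unfolding F_root_def F1_def F2_def F3_def
  by (simp add: algebra_simps power2_eq_square power3_eq_cube)

lemma phi_eq:
  "phi = mp_var 3 * F1 (mp_var 0) (mp_var 1) (mp_var 2)
    + mp_var 4 * F2 (mp_var 0) (mp_var 1) (mp_var 2)
    + mp_var 5 * F3 (mp_var 0) (mp_var 1) (mp_var 2)"
  by (simp add: phi_def F1_def F2_def F3_def Let_def)

lemma (in comm_ring_hom) hom_F:
  "hom (F1 x1 x2 x3) = F1 (hom x1) (hom x2) (hom x3)"
  "hom (F2 x1 x2 x3) = F2 (hom x1) (hom x2) (hom x3)"
  "hom (F3 x1 x2 x3) = F3 (hom x1) (hom x2) (hom x3)"
  by (simp_all add: F1_def F2_def F3_def hom_distribs)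

definition F_poly :: "nat \<Rightarrow> 'a::comm_ring_1 mpoly" where
  "F_poly i = [F1 (mp_var 0) (mp_var 1) (mp_var 2), F2 (mp_var 0) (mp_var 1) (mp_var 2),
     F3 (mp_var 0) (mp_var 1) (mp_var 2)] ! i"

lemma phi_eq_F_poly: "phi = mp_var 3 * F_poly 0 + mp_var 4 * F_poly 1 + mp_var 5 * F_poly 2"
  by (simp add: phi_eq F_poly_def numeral_2_eq_2)

lemma mp_deriv_F_poly:
  assumes "i < 3" "3 \<le> j"
  shows "mp_deriv j (F_poly i) = 0"
proof -
  have "i = 0 \<or> i = 1 \<or> i = 2" using assms by auto
  then show ?thesis
    using assms(2)
    by (elim disjE) (simp_all add: F_poly_def F1_def F2_def F3_def mp_deriv_rules)
qed

lemma phi_in_mpolys: "(phi :: 'a::comm_ring_1 mpoly) \<in> mpolys 6"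
  unfolding phi_def Let_def
  by (intro mpolys_add mpolys_mult mpolys_diff mpolys_power mpolys_1 mpolys_numeral mpolys_var)
    simp_all

lemma mp_deriv_phi_x:
  assumes "i < 3"
  shows "mp_deriv i phi = mp_var 3 * mp_deriv i (F_poly 0)
    + mp_var 4 * mp_deriv i (F_poly 1) + mp_var 5 * mp_deriv i (F_poly 2)"
  using assms by (simp add: phi_eq_F_poly mp_deriv_rules)

lemma mp_deriv_phi_y:
  assumes "i < 3"
  shows "mp_deriv (i + 3) phi = F_poly i"
proof -
  have "i = 0 \<or> i = 1 \<or> i = 2" using assms by auto
  then show ?thesis
    by (elim disjE) (simp_all add: phi_eq_F_poly mp_deriv_rules mp_deriv_F_poly)
qed

lemma det_Jacobian_F:
  "det (mat 3 3 (\<lambda>(i, j). mp_deriv j (F_poly i :: 'a::comm_ring_1 mpoly))) = - 2"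
proof -
  define J :: "'a mpoly mat" where "J = mat 3 3 (\<lambda>(i, j). mp_deriv j (F_poly i))"
  define x1 x2 x3 :: "'a mpoly" where vars: "x1 = mp_var 0" "x2 = mp_var 1" "x3 = mp_var 2"
  define u where "u = 1 + x1 * x2"
  have d: "mp_deriv 0 x1 = 1" "mp_deriv 1 x1 = 0" "mp_deriv 2 x1 = 0"
    "mp_deriv 0 x2 = 0" "mp_deriv 1 x2 = 1" "mp_deriv 2 x2 = 0"
    "mp_deriv 0 x3 = 0" "mp_deriv 1 x3 = 0" "mp_deriv 2 x3 = 1"
    unfolding vars by (simp_all add: mp_deriv_var)
  \<comment> \<open>The simplifier rewrites the index \<open>1\<close> to \<open>Suc 0\<close>, so both forms of these rules are needed.\<close>
  note d' = d[simplified]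
  have J: "J \<in> carrier_mat 3 3" by (simp add: J_def)
  have du: "mp_deriv i u = mp_deriv i x1 * x2 + x1 * mp_deriv i x2" for i
    by (simp add: u_def mp_deriv_rules)
  \<comment> \<open>Since \<open>4 + 3 x\<^sub>1 x\<^sub>2 = 1 + 3 u\<close>, keeping \<open>u\<close> unexpanded keeps the entries of \<open>J\<close> short.\<close>
  have F: "F_poly 0 = u ^ 3 * x3 + x2 ^ 2 * u * (1 + 3 * u)"
    "F_poly (Suc 0) = x2 + 3 * x1 * u ^ 2 * x3 + 3 * x1 * x2 ^ 2 * (1 + 3 * u)"
    "F_poly 2 = 2 * x1 - 3 * x1 ^ 2 * x2 - x1 ^ 3 * x3"
    unfolding F_poly_def vars[symmetric] by (simp_all add: F1_def F2_def F3_def u_def algebra_simps)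
  have J0: "J $$ (0, 0) = 3 * u ^ 2 * x2 * x3 + x2 ^ 3 * (1 + 6 * u)"
    "J $$ (0, 1) = 3 * u ^ 2 * x1 * x3 + 2 * x2 * u * (1 + 3 * u) + x2 ^ 2 * x1 * (1 + 6 * u)"
    "J $$ (0, 2) = u ^ 3"
    by (simp_all add: J_def F mp_deriv_rules du d d' algebra_simps power2_eq_square power3_eq_cube)
  have J1: "J $$ (1, 0) = 3 * u ^ 2 * x3 + 6 * x1 * x2 * u * x3 + 3 * x2 ^ 2 * (1 + 3 * u) + 9 * x1 * x2 ^ 3"
    "J $$ (1, 1) = 1 + 6 * x1 ^ 2 * u * x3 + 6 * x1 * x2 * (1 + 3 * u) + 9 * x1 ^ 2 * x2 ^ 2"
    "J $$ (1, 2) = 3 * x1 * u ^ 2"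
    by (simp_all add: J_def F mp_deriv_rules du d d' algebra_simps power2_eq_square power3_eq_cube)
  have J2: "J $$ (2, 0) = 2 - 6 * x1 * x2 - 3 * x1 ^ 2 * x3"
    "J $$ (2, 1) = - (3 * x1 ^ 2)"
    "J $$ (2, 2) = - (x1 ^ 3)"
    by (simp_all add: J_def F mp_deriv_rules du d d' algebra_simps power2_eq_square power3_eq_cube)
  show ?thesis
    unfolding J_def[symmetric] det_3x3[OF J] J0 J1 J2 u_def
    by (simp add: algebra_simps power2_eq_square power3_eq_cube)
qed

lemma det_Hess_phi: "det (Hess 6 (phi :: 'a::field_char_0 mpoly)) = mp_const (- 4)"
proof -
  define A :: "'a mpoly mat" where "A = mat 3 3 (\<lambda>(i, j). mp_deriv i (mp_deriv j phi))"
  define J :: "'a mpoly mat" where "J = mat 3 3 (\<lambda>(i, j). mp_deriv j (F_poly i))"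
  have A: "A \<in> carrier_mat 3 3" and J: "J \<in> carrier_mat 3 3"
    by (simp_all add: A_def J_def)
  have phi_y: "mp_deriv k phi = (F_poly (k - 3) :: 'a mpoly)" if "\<not> k < 3" "k < 6" for k
  proof -
    have "k - 3 < 3" "k - 3 + 3 = k" using that by arith+
    then show ?thesis using mp_deriv_phi_y[of "k - 3"] by metis
  qed
  have "Hess 6 (phi :: 'a mpoly) = four_block_mat A (transpose_mat J) J (0\<^sub>m 3 3)"
  proof (rule eq_matI)
    fix i j assume ij: "i < dim_row (four_block_mat A (transpose_mat J) J (0\<^sub>m 3 3))"
      "j < dim_col (four_block_mat A (transpose_mat J) J (0\<^sub>m 3 3))"
    have "mp_deriv i (F_poly (j - 3) :: 'a mpoly) = 0" if "\<not> i < 3" "\<not> j < 3"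
      using that ij J A by (intro mp_deriv_F_poly) simp_all
    moreover have "mp_deriv i (mp_deriv j phi) = mp_deriv j (F_poly (i - 3) :: 'a mpoly)"
      if "\<not> i < 3" "j < 3"
      using that ij J A phi_y[of i] mp_deriv_commute[of i j "phi :: 'a mpoly"] by simp
    ultimately show "Hess 6 (phi :: 'a mpoly) $$ (i, j)
        = four_block_mat A (transpose_mat J) J (0\<^sub>m 3 3) $$ (i, j)"
      using ij A J phi_y[of j]
      by (simp add: Hess_def A_def J_def)
  qed (simp_all add: Hess_def A_def J_def)
  moreover have "det J = - 2"
    unfolding J_def by (rule det_Jacobian_F)
  ultimately show ?thesis
    by (simp add: det_zero_block[OF A J] mp_const_def single_uminus)
qed

lemma (in comm_ring_hom) mp_eval_F_poly:
  "mp_eval hom x (F_poly 0) = F1 (x $ 0) (x $ 1) (x $ 2)"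
  "mp_eval hom x (F_poly (Suc 0)) = F2 (x $ 0) (x $ 1) (x $ 2)"
  "mp_eval hom x (F_poly 2) = F3 (x $ 0) (x $ 1) (x $ 2)"
  by (simp_all add: F_poly_def comm_ring_hom.hom_F[OF comm_ring_hom_mp_eval])

text \<open>Each partial derivative in an \<open>x\<close>-direction is linear in \<open>y\<close>, so at \<open>y = 0\<close> only the values of
  \<open>F\<close> remain.\<close>

lemma grad_map_phi_zero_section:
  fixes v :: "'a::comm_ring_1 vec"
  assumes "v $ 3 = 0" "v $ 4 = 0" "v $ 5 = 0"
  shows "grad_map 6 phi v = vec 6 (\<lambda>i. [0, 0, 0, F1 (v $ 0) (v $ 1) (v $ 2),
    F2 (v $ 0) (v $ 1) (v $ 2), F3 (v $ 0) (v $ 1) (v $ 2)] ! i)"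
    (is "_ = vec 6 (\<lambda>i. ?F ! i)")
proof (rule eq_vecI)
  note eval_var = comm_ring_hom.mp_eval_var[OF comm_ring_hom_id]
    and eval_F = comm_ring_hom.mp_eval_F_poly[OF comm_ring_hom_id]
  interpret E: comm_ring_hom "mp_eval (\<lambda>c :: 'a. c) v"
    by (rule comm_ring_hom.comm_ring_hom_mp_eval[OF comm_ring_hom_id])
  fix i assume "i < dim_vec (vec 6 (\<lambda>i. ?F ! i))"
  then have i: "i < 6" by simp
  then have index: "grad_map 6 phi v $ i = mp_eval (\<lambda>c. c) v (mp_deriv i phi)"
    by (simp add: grad_map_def grad_def)
  have "mp_eval (\<lambda>c. c) v (mp_deriv i phi) = ?F ! i"
  proof (cases "i < 3")
    case True
    then have "mp_eval (\<lambda>c. c) v (mp_deriv i phi) = (0 :: 'a)"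
      by (simp add: mp_deriv_phi_x E.hom_add E.hom_mult eval_var assms)
    moreover have "i = 0 \<or> i = 1 \<or> i = 2" using True by auto
    ultimately show ?thesis
      by (elim disjE) simp_all
  next
    case False
    define j where "j = i - 3"
    have i_j: "i = j + 3" and "j < 3" using False i by (auto simp: j_def)
    then have "j = 0 \<or> j = Suc 0 \<or> j = 2" by auto
    moreover have "mp_deriv i phi = (F_poly j :: 'a mpoly)"
      unfolding i_j using \<open>j < 3\<close> by (rule mp_deriv_phi_y)
    ultimately show ?thesis
      by (elim disjE) (simp_all add: i_j eval_F)
  qed
  then show "grad_map 6 phi v $ i = vec 6 (\<lambda>i. ?F ! i) $ i"
    using i index by simp
qed (simp add: grad_map_def grad_def)

text \<open>Over the point \<open>(0, - 1/2, 6)\<close> the cubic equation for \<open>r\<close> is \<open>r (r - 3) (r + 1) = 0\<close>. The two points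
  below belong to the roots \<open>3\<close> and \<open>- 1\<close>, with \<open>(s, u) = (6, 1/2)\<close> and \<open>(2, - 1/2)\<close>.\<close>

lemma grad_map_phi_not_inj:
  "\<not> inj_on (grad_map 6 (phi :: 'a::field_char_0 mpoly)) (carrier_vec 6)"
proof
  define v :: "'a vec" where "v = vec 6 (\<lambda>i. [1, - 1 / 2, - 5 / 2, 0, 0, 0] ! i)"
  define w :: "'a vec" where "w = vec 6 (\<lambda>i. [3, - 1 / 2, 1 / 2, 0, 0, 0] ! i)"
  have v: "v $ 0 = 1" "v $ 1 = - 1 / 2" "v $ 2 = - 5 / 2" "v $ 3 = 0" "v $ 4 = 0" "v $ 5 = 0"
    and w: "w $ 0 = 3" "w $ 1 = - 1 / 2" "w $ 2 = 1 / 2" "w $ 3 = 0" "w $ 4 = 0" "w $ 5 = 0"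
    by (simp_all add: v_def w_def)
  assume inj: "inj_on (grad_map 6 (phi :: 'a mpoly)) (carrier_vec 6)"
  have "F1 (v $ 0) (v $ 1) (v $ 2) = F1 (w $ 0) (w $ 1) (w $ 2)"
    "F2 (v $ 0) (v $ 1) (v $ 2) = F2 (w $ 0) (w $ 1) (w $ 2)"
    "F3 (v $ 0) (v $ 1) (v $ 2) = F3 (w $ 0) (w $ 1) (w $ 2)"
    unfolding v w F1_def F2_def F3_def
    by (simp_all add: field_simps power2_eq_square power3_eq_cube)
  then have "grad_map 6 phi v = grad_map 6 phi w"
    unfolding grad_map_phi_zero_section[OF v(4-6)] grad_map_phi_zero_section[OF w(4-6)]
    by (simp only:)
  moreover have "v \<in> carrier_vec 6" "w \<in> carrier_vec 6"
    by (simp_all add: v_def w_def)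
  ultimately have "v = w"
    using inj by (meson inj_onD)
  with v(1) w(1) show False by simp
qed

section \<open>The Legendre transform\<close>

lemma keys_add_monomial:
  "Poly_Mapping.keys (a + b :: monomial) = Poly_Mapping.keys a \<union> Poly_Mapping.keys b"
  by (auto simp: in_keys_iff lookup_add)

text \<open>Setting to zero all variables outside \<open>V\<close>.\<close>

definition mfps_restrict :: "nat set \<Rightarrow> 'a::zero mfps \<Rightarrow> 'a mfps" where
  "mfps_restrict V f = Mfps (\<lambda>m. if Poly_Mapping.keys m \<subseteq> V then mfps_coeff f m else 0)"

lemma comm_ring_hom_mfps_restrict:
  "comm_ring_hom (mfps_restrict V :: 'a::comm_ring_1 mfps \<Rightarrow> 'a mfps)"
proof
  fix f g :: "'a mfps"
  show "mfps_restrict V (f * g) = mfps_restrict V f * mfps_restrict V g"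
    unfolding mfps_eq_iff
  proof
    fix m
    show "mfps_coeff (mfps_restrict V (f * g)) m
        = mfps_coeff (mfps_restrict V f * mfps_restrict V g) m"
    proof (cases "Poly_Mapping.keys m \<subseteq> V")
      case True
      then have "Poly_Mapping.keys a \<subseteq> V \<and> Poly_Mapping.keys b \<subseteq> V"
        if "(a, b) \<in> splits m" for a b
        using that keys_add_monomial[of a b] by (simp add: splits_def)
      with True show ?thesis
        by (auto simp: mfps_restrict_def mfps_coeff_mult intro!: sum.cong)
    next
      case False
      then have "\<not> Poly_Mapping.keys a \<subseteq> V \<or> \<not> Poly_Mapping.keys b \<subseteq> V"
        if "(a, b) \<in> splits m" for a b
        using that keys_add_monomial[of a b] by (auto simp: splits_def)
      then have "mfps_coeff (mfps_restrict V f * mfps_restrict V g) m = 0"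
        unfolding mfps_coeff_mult by (intro sum.neutral) (auto simp: mfps_restrict_def)
      with False show ?thesis by (simp add: mfps_restrict_def)
    qed
  qed
qed (simp_all add: mfps_restrict_def mfps_eq_iff one_mfps_def)

lemma mfps_restrict_var: "mfps_restrict V (mfps_var i) = (if i \<in> V then mfps_var i else 0)"
  by (simp add: mfps_restrict_def mfps_var_def mfps_eq_iff)

text \<open>The specialisation \<open>b\<^sub>3 = 1\<close> used below makes sense for polynomials only. This injective homomorphism
  carries equations between series with finite support over to polynomials.\<close>

definition mfps_of_mpoly :: "'a::zero mpoly \<Rightarrow> 'a mfps" where
  "mfps_of_mpoly f = Mfps (Poly_Mapping.lookup f)"

lemma mfps_of_mpoly_eq_iff [simp]: "mfps_of_mpoly f = mfps_of_mpoly g \<longleftrightarrow> f = g"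
  by (simp add: mfps_of_mpoly_def mfps_eq_iff poly_mapping_eq_iff fun_eq_iff)

lemma mfps_of_mpoly_add: "mfps_of_mpoly (f + g) = mfps_of_mpoly f + mfps_of_mpoly g"
  for f g :: "'a::comm_ring_1 mpoly"
  by (simp add: mfps_of_mpoly_def mfps_eq_iff lookup_add)

lemma comm_ring_hom_mfps_of_mpoly:
  "comm_ring_hom (mfps_of_mpoly :: 'a::comm_ring_1 mpoly \<Rightarrow> 'a mfps)"
proof
  fix f g :: "'a mpoly"
  show "mfps_of_mpoly (f * g) = mfps_of_mpoly f * mfps_of_mpoly g"
  proof (induction f rule: mpoly_induct)
    case (single a c)
    show ?case
    proof (induction g rule: mpoly_induct)
      case (single b d)
      have "mfps_coeff (mfps_of_mpoly (Poly_Mapping.single a c)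
            * mfps_of_mpoly (Poly_Mapping.single b d)) m
          = mfps_coeff (mfps_of_mpoly (Poly_Mapping.single (a + b) (c * d))) m" for m
      proof -
        have "mfps_coeff (mfps_of_mpoly (Poly_Mapping.single a c)
              * mfps_of_mpoly (Poly_Mapping.single b d)) m
            = (\<Sum>p\<in>splits m. if p = (a, b) then c * d else 0)"
          unfolding mfps_coeff_mult
          by (intro sum.cong)
            (auto simp: mfps_of_mpoly_def lookup_single when_def split: if_splits)
        also have "\<dots> = (if (a, b) \<in> splits m then c * d else 0)"
          by simp
        also have "\<dots> = mfps_coeff (mfps_of_mpoly (Poly_Mapping.single (a + b) (c * d))) m"
          by (simp add: splits_def mfps_of_mpoly_def lookup_single when_def)
        finally show ?thesis .
      qed
      then show ?case
        by (simp add: mfps_eq_iff mult_single)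
    qed (simp add: distrib_left mfps_of_mpoly_add)
  qed (simp add: distrib_right mfps_of_mpoly_add)
qed (simp_all add: mfps_of_mpoly_add, simp_all add: mfps_of_mpoly_def mfps_eq_iff lookup_one
    when_def one_mfps_def)

lemma mfps_of_mpoly_var: "mfps_of_mpoly (mp_var i) = mfps_var i"
  by (auto simp: mfps_of_mpoly_def mfps_eq_iff mp_var_def mfps_var_def lookup_single when_def)

lemma is_polynomial_imp_mfps_of_mpoly:
  assumes "is_polynomial f"
  shows "\<exists>g. mfps_of_mpoly g = f"
proof
  show "mfps_of_mpoly (Abs_poly_mapping (mfps_coeff f)) = f"
    using assms by (simp add: is_polynomial_def mfps_of_mpoly_def mfps_eq_iff)
qed

text \<open>Subtraction of exponents is truncated, so a monomial that is not divisible by the variable needs a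
  case of its own.\<close>

lemma mfps_coeff_var_mult:
  "mfps_coeff (mfps_var i * f) m
    = (if Poly_Mapping.lookup m i = 0 then 0 else mfps_coeff f (m - Poly_Mapping.single i 1))"
  for f :: "'a::comm_ring_1 mfps"
proof -
  let ?e = "Poly_Mapping.single i (1 :: nat)"
  have "mfps_coeff (mfps_var i * f) m
      = (\<Sum>p\<in>splits m. if p = (?e, m - ?e) then mfps_coeff f (m - ?e) else 0)"
    unfolding mfps_coeff_mult
    by (intro sum.cong) (auto simp: mfps_var_def splits_def split: if_splits)
  also have "\<dots> = (if (?e, m - ?e) \<in> splits m then mfps_coeff f (m - ?e) else 0)"
    by simp
  also have "(?e, m - ?e) \<in> splits m \<longleftrightarrow> Poly_Mapping.lookup m i \<noteq> 0"
  proof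
    assume "(?e, m - ?e) \<in> splits m"
    then have "Poly_Mapping.lookup (?e + (m - ?e)) i = Poly_Mapping.lookup m i"
      by (simp add: splits_def)
    then show "Poly_Mapping.lookup m i \<noteq> 0" by (simp add: lookup_add)
  next
    assume "Poly_Mapping.lookup m i \<noteq> 0"
    then show "(?e, m - ?e) \<in> splits m"
      using monomial_split[of i m] by (simp add: in_keys_iff splits_def)
  qed
  finally show ?thesis by simp
qed

text \<open>Let \<open>m\<close> be a monomial in the variables of \<open>V\<close> and \<open>v\<^sub>i\<close> the variable with index \<open>i\<close>. No other variable
  with index in \<open>I\<close> divides \<open>m v\<^sub>i\<close>, so the coefficient of \<open>m v\<^sub>i\<close> in the sum is that of \<open>m\<close> in \<open>x i\<close>.\<close>

lemma restrict_polynomial_if_linear_form_polynomial: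
  fixes x :: "nat \<Rightarrow> 'a::comm_ring_1 mfps"
  assumes fin: "is_polynomial (\<Sum>j\<in>I. mfps_var j * x j)"
    and I: "finite I" "i \<in> I" "I \<inter> V = {}"
  shows "is_polynomial (mfps_restrict V (x i))"
proof -
  let ?e = "Poly_Mapping.single i (1 :: nat)"
  have "mfps_coeff (\<Sum>j\<in>I. mfps_var j * x j) (m + ?e) = mfps_coeff (x i) m"
    if "Poly_Mapping.keys m \<subseteq> V" for m
  proof -
    have m: "Poly_Mapping.lookup m j = 0" if "j \<in> I" for j
      using \<open>Poly_Mapping.keys m \<subseteq> V\<close> that I(3) by (auto simp: in_keys_iff)
    have "mfps_coeff (\<Sum>j\<in>I. mfps_var j * x j) (m + ?e)
        = (\<Sum>j\<in>I. if j = i then mfps_coeff (x i) m else 0)"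
      unfolding mfps_coeff_sum mfps_coeff_var_mult
      by (intro sum.cong) (auto simp: lookup_add lookup_single when_def m)
    then show ?thesis using I by simp
  qed
  then have "(\<lambda>m. m + ?e) ` {m. mfps_coeff (mfps_restrict V (x i)) m \<noteq> 0}
      \<subseteq> {m. mfps_coeff (\<Sum>j\<in>I. mfps_var j * x j) m \<noteq> 0}"
    by (auto simp: mfps_restrict_def split: if_splits)
  then have "finite ((\<lambda>m. m + ?e) ` {m. mfps_coeff (mfps_restrict V (x i)) m \<noteq> 0})"
    using fin unfolding is_polynomial_def by (rule finite_subset)
  then show ?thesis
    unfolding is_polynomial_def by (rule finite_imageD) (simp add: inj_on_def)
qed

text \<open>The cubic equation becomes \<open>r\<^sup>2 (r - 2) = 2 t\<close>. A constant \<open>r\<close> makes the left side constant, and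
  any other \<open>r\<close> makes its degree at least three.\<close>

lemma no_polynomial_preimage:
  fixes q1 q2 q3 :: "'a::field_char_0 poly"
  assumes "F1 q1 q2 q3 = [:0, 1:]" "F2 q1 q2 q3 = 0" "F3 q1 q2 q3 = 1"
  shows False
proof -
  let ?r = "F_root q1 q2 q3"
  have "?r ^ 3 - 2 * ?r ^ 2 - 2 * [:0, 1:] = 0"
    using F_root_cubic[of q1 q2 q3] by (simp add: assms)
  then have eq: "?r ^ 2 * (?r - 2) = [:0, 2:]"
    by (simp add: algebra_simps power2_eq_square power3_eq_cube numeral_poly)
  then have nz: "?r \<noteq> 0" "?r - 2 \<noteq> 0"
    by auto
  have "2 * degree ?r + degree (?r - 2) = degree (?r ^ 2 * (?r - 2))"
    using nz by (simp add: degree_mult_eq degree_power_eq)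
  also have "\<dots> = 1" unfolding eq by simp
  finally have sum: "2 * degree ?r + degree (?r - 2) = 1" .
  then have "degree ?r = 0" "degree (?r - 2) = 1" by presburger+
  moreover have "degree (?r - 2) \<le> max (degree ?r) (degree (2 :: 'a poly))"
    by (rule degree_diff_le_max)
  ultimately show False by simp
qed

lemma legendre_phi_not_polynomial:
  "\<not> is_polynomial (legendre 6 (phi :: 'a::field_char_0 mpoly))"
proof
  assume poly: "is_polynomial (legendre 6 (phi :: 'a mpoly))"
  interpret C: comm_ring_hom "mfps_const :: 'a \<Rightarrow> 'a mfps" by (rule comm_ring_hom_mfps_const)
  define x where "x = formal_inverse 6 (phi :: 'a mpoly)"
  have "\<exists>!x. is_formal_inverse 6 (phi :: 'a mpoly) x"
    using formal_inverse_exists_unique[OF phi_in_mpolys det_Hess_phi] by simp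
  then have inv: "is_formal_inverse 6 phi x"
    unfolding x_def formal_inverse_def by (rule theI')
  have x: "x \<in> carrier_vec 6"
    using inv by (simp add: is_formal_inverse_def)
  have "grad_map 6 phi (0\<^sub>v 6 :: 'a vec) = 0\<^sub>v 6"
    by (subst grad_map_phi_zero_section)
      (auto simp: F1_def F2_def F3_def numeral_eq_Suc less_Suc_eq intro!: eq_vecI)
  then have dual: "dual_vars 6 (phi :: 'a mpoly) $ i = mfps_var i" if "i < 6" for i
    using that by (simp add: dual_vars_def)
  have "mp_eval mfps_const x (mp_deriv i phi) = mfps_var i" if "i < 6" for i
  proof -
    have "map_vec (mp_eval mfps_const x) (grad 6 phi) $ i = dual_vars 6 phi $ i"
      using inv by (simp add: is_formal_inverse_def)
    then show ?thesis using that by (simp add: grad_def dual)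
  qed
  then have "mp_eval mfps_const x (mp_deriv (i + 3) phi) = mfps_var (i + 3)" if "i < 3" for i
    using that by simp
  then have "mp_eval mfps_const x (F_poly i) = mfps_var (i + 3)" if "i < 3" for i
    using mp_deriv_phi_y[OF that, where 'a = 'a] that by metis
  from this[of 0] this[of "Suc 0"] this[of 2]
  have F: "F1 (x $ 0) (x $ Suc 0) (x $ 2) = mfps_var 3"
    "F2 (x $ 0) (x $ Suc 0) (x $ 2) = mfps_var 4"
    "F3 (x $ 0) (x $ Suc 0) (x $ 2) = mfps_var 5"
    by (simp_all add: C.mp_eval_F_poly)

  \<comment> \<open>The part of the pairing that belongs to \<open>y\<close> cancels against \<open>\<phi>(x, y)\<close>.\<close>
  have "mp_eval mfps_const x phi = x $ 3 * mfps_var 3 + x $ 4 * mfps_var 4 + x $ 5 * mfps_var 5"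
    by (simp add: phi_eq_F_poly C.mp_eval_add C.mp_eval_mult C.mp_eval_F_poly F)
  moreover have "dual_vars 6 phi \<bullet> x = (\<Sum>i\<in>{0..<6}. mfps_var i * x $ i)"
    using x by (simp add: scalar_prod_def dual)
  moreover have "{0..<6} = {0, 1, 2, 3, 4, 5 :: nat}" by auto
  ultimately have "legendre 6 phi = (\<Sum>i\<in>{0, 1, 2}. mfps_var i * x $ i)"
    unfolding legendre_def x_def[symmetric] by (simp add: algebra_simps)
  \<comment> \<open>Index \<open>4\<close>, the dual variable \<open>b\<^sub>2\<close>, is left out: \<open>b\<^sub>2 = 0\<close> removes the linear term of the cubic.\<close>
  then have "is_polynomial (mfps_restrict {3, 5} (x $ i))" if "i \<in> {0, 1, 2}" for i
    using restrict_polynomial_if_linear_form_polynomial[of "\<lambda>i. x $ i" "{0, 1, 2}" i "{3, 5}"] poly that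
    by simp
  then have "\<forall>i\<in>{0, 1, 2}. \<exists>g. mfps_of_mpoly g = mfps_restrict {3, 5} (x $ i)"
    using is_polynomial_imp_mfps_of_mpoly by blast
  then obtain g where g: "\<forall>i\<in>{0, 1, 2}. mfps_of_mpoly (g i) = mfps_restrict {3, 5} (x $ i)"
    by (rule bchoice[THEN exE])

  interpret R: comm_ring_hom "mfps_restrict {3, 5} :: 'a mfps \<Rightarrow> 'a mfps"
    by (rule comm_ring_hom_mfps_restrict)
  interpret M: comm_ring_hom "mfps_of_mpoly :: 'a mpoly \<Rightarrow> 'a mfps"
    by (rule comm_ring_hom_mfps_of_mpoly)
  have "mfps_of_mpoly (F1 (g 0) (g 1) (g 2)) = mfps_of_mpoly (mp_var 3)"
    "mfps_of_mpoly (F2 (g 0) (g 1) (g 2)) = mfps_of_mpoly 0"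
    "mfps_of_mpoly (F3 (g 0) (g 1) (g 2)) = mfps_of_mpoly (mp_var 5)"
    using g by (simp_all add: M.hom_F R.hom_F[symmetric] F mfps_restrict_var mfps_of_mpoly_var
        del: mfps_of_mpoly_eq_iff)
  then have Fg: "F1 (g 0) (g 1) (g 2) = mp_var 3" "F2 (g 0) (g 1) (g 2) = 0"
    "F3 (g 0) (g 1) (g 2) = mp_var 5"
    by (simp_all only: mfps_of_mpoly_eq_iff)

  interpret P: comm_ring_hom "\<lambda>c :: 'a. [:c:]"
    by standard (auto simp: one_pCons)
  \<comment> \<open>Specialisation to \<open>b\<^sub>1 = t\<close> and \<open>b\<^sub>3 = 1\<close>.\<close>
  define h where "h = mp_eval (\<lambda>c :: 'a. [:c:]) (vec 6 (\<lambda>i. if i = 3 then [:0, 1:] else 1))"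
  interpret h: comm_ring_hom h
    unfolding h_def by (rule P.comm_ring_hom_mp_eval)
  have "F1 (h (g 0)) (h (g 1)) (h (g 2)) = [:0, 1:]" "F2 (h (g 0)) (h (g 1)) (h (g 2)) = 0"
    "F3 (h (g 0)) (h (g 1)) (h (g 2)) = 1"
    unfolding h.hom_F[symmetric] Fg h.hom_zero by (simp_all add: h_def P.mp_eval_var)
  then show False by (rule no_polynomial_preimage)
qed

theorem proposition5p1:
  shows "det (Hess 6 (phi :: 'a::field_char_0 mpoly)) = mp_const (- 4)
    \<and> \<not> inj_on (grad_map 6 (phi :: 'a mpoly)) (carrier_vec 6)
    \<and> \<not> is_polynomial (legendre 6 (phi :: 'a mpoly))
    \<and> \<not> Hessian_conjecture TYPE('a) 6"
proof (intro conjI)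
  show "det (Hess 6 (phi :: 'a mpoly)) = mp_const (- 4)"
    by (rule det_Hess_phi)
  show "\<not> inj_on (grad_map 6 (phi :: 'a mpoly)) (carrier_vec 6)"
    by (rule grad_map_phi_not_inj)
  show *: "\<not> is_polynomial (legendre 6 (phi :: 'a mpoly))"
    by (rule legendre_phi_not_polynomial)
  have "(- 4 :: 'a) \<noteq> 0" by simp
  with * phi_in_mpolys det_Hess_phi show "\<not> Hessian_conjecture TYPE('a) 6"
    unfolding Hessian_conjecture_def by blast
qed

end
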